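(* Assume there exist $\varepsilon_{\mathbb S}>0$ and a sequence $(a_n)_{n\ge1}$ of positive reals with $\sum_{n\ge1}a_n=\infty$ such that for every $(s,\varepsilon)\in\mathbb S\times(0,\varepsilon_{\mathbb S})$ and every bounded measurable $f:\mathbb X\to[0,+\infty)$, with $B:=B(s,\varepsilon)$, $$\mathbb E_{(\pi,0)}\big[f(X_n)\mathbf 1_B(S_n)\big]\sim a_n\,\pi(f)\,m_{\mathbb S}(B)\quad(n\to\infty). \tag{LL0}$$ Then (a) $\mathcal R_{(\pi,0)}=\mathbb S$; (b) if moreover $(X_n)_n$ is Harris recurrent, then $\mathcal R_{(\mu,0)}=\mathbb S$ for every probability measure $\mu$ on $(\mathbb X,\mathcal X)$.
   Context: $(\mathbb X,\mathcal X)$ is a measurable space. A Markov random walk (MRW) on $\mathbb X\times\mathbb R^2$ is a Markov chain $(X_n,S_n)_{n\ge0}$ with values in $\mathbb X\times\mathbb R^2$ whose transition kernel $P$ satisfies $P((x,s);A\times S)=P((x,0);A\times(S-s))$ for all $(x,s)\in\mathbb X\times\mathbb R^2$, $A\in\mathcal X$ and Borel $S\subset\mathbb R^2$; then $(X_n)_n$ is itself a Markov chain (the driving chain), with transition kernel denoted $Q$. One always takes $S_0=0$. For a probability measure $\mu$ on $\mathbb X$, $\mathbb P_{(\mu,0)}$ (expectation $\mathbb E_{(\mu,0)}$) is the law of the chain with $X_0\sim\mu$, $S_0=0$; $\mathbb P_{(x,0)}:=\mathbb P_{(\delta_x,0)}$. Standing assumptions: $Q$ has an invariant probability measure $\pi$;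 $S_1$ is $\mathbb P_{(\pi,0)}$-integrable with $\mathbb E_{(\pi,0)}[S_1]=0$; there is a two-dimensional closed subgroup $\mathbb S$ of $\mathbb R^2$ with $\mathbb P_{(x,0)}(S_n\in\mathbb S)=1$ for all $x\in\mathbb X$, $n\ge0$. $|\cdot|$ is the Euclidean norm, $B(s,\varepsilon)$ the open Euclidean ball, $m_{\mathbb S}$ a Haar measure on $\mathbb S$ (viewed as a measure on $\mathbb R^2$). The recurrence set is $\mathcal R_{(\mu,0)}:=\{s\in\mathbb S:\ \forall\varepsilon>0,\ \mathbb P_{(\mu,0)}(|S_n-s|<\varepsilon\text{ for infinitely many }n)=1\}$, $\mathcal R_{(x,0)}:=\mathcal R_{(\delta_x,0)}$. $(X_n)_n$ is Harris recurrent if for every $B\in\mathcal X$ with $\pi(B)>0$ and every $x\in\mathbb X$, $\mathbb P_{(x,0)}(X_k\in B\text{ for infinitely many }k)=1$. *)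

theory Defs
  imports "HOL-Probability.Probability" "HOL-Library.Landau_Symbols"
begin

type_synonym 'x mrw_state = "'x \<times> (real ^ 2)"

text \<open>The transition kernel of the MRW is encoded by K x = P((x,0); .), a probability
  measure on X x R^2; by the translation invariance P((x,s); A x S) = K x (A x (S - s)).
  Step kernels for the Ionescu-Tulcea construction of the path measure:
  step 0 draws (X_0, S_0) = (X_0, 0) with X_0 ~ mu, step i > 0 draws
  (X_i, S_i) from P((X_{i-1}, S_{i-1}); .).\<close>

definition mrw_step ::
  "'x measure \<Rightarrow> ('x \<Rightarrow> 'x mrw_state measure) \<Rightarrow> 'x measure \<Rightarrow> nat
     \<Rightarrow> (nat \<Rightarrow> 'x mrw_state) \<Rightarrow> 'x mrw_state measure" where
  "mrw_step M K \<mu> i \<omega> =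
     (if i = 0 then distr \<mu> (M \<Otimes>\<^sub>M borel) (\<lambda>x. (x, 0))
      else distr (K (fst (\<omega> (i - 1)))) (M \<Otimes>\<^sub>M borel)
             (\<lambda>(y, t). (y, snd (\<omega> (i - 1)) + t)))"

definition mrw_law ::
  "'x measure \<Rightarrow> ('x \<Rightarrow> 'x mrw_state measure) \<Rightarrow> 'x measure \<Rightarrow> (nat \<Rightarrow> 'x mrw_state) measure" where
  "mrw_law M K \<mu> =
     projective_family.lim UNIV
       (Ionescu_Tulcea.CI (mrw_step M K \<mu>) (\<lambda>_. M \<Otimes>\<^sub>M borel)) (\<lambda>_. M \<Otimes>\<^sub>M borel)"

definition recurrence_set ::
  "'x measure \<Rightarrow> ('x \<Rightarrow> 'x mrw_state measure) \<Rightarrow> (real ^ 2) set \<Rightarrow> 'x measure \<Rightarrow> (real ^ 2) set" where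
  "recurrence_set M K S \<mu> =
     {s \<in> S. \<forall>\<epsilon>>0. measure (mrw_law M K \<mu>)
        {\<omega> \<in> space (mrw_law M K \<mu>). \<exists>\<^sub>\<infinity>n. norm (snd (\<omega> n) - s) < \<epsilon>} = 1}"

definition drive_kernel :: "('x \<Rightarrow> 'x mrw_state measure) \<Rightarrow> 'x \<Rightarrow> 'x set \<Rightarrow> real" where
  "drive_kernel K x A = measure (K x) (A \<times> UNIV)"

definition invariant_prob :: "'x measure \<Rightarrow> ('x \<Rightarrow> 'x mrw_state measure) \<Rightarrow> 'x measure \<Rightarrow> bool" where
  "invariant_prob M K \<pi> \<longleftrightarrow> prob_space \<pi> \<and> sets \<pi> = sets M \<and>
     (\<forall>A \<in> sets M. measure \<pi> A = (\<integral>x. drive_kernel K x A \<partial>\<pi>))"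

definition closed_subgroup_2d :: "(real ^ 2) set \<Rightarrow> bool" where
  "closed_subgroup_2d S \<longleftrightarrow> closed S \<and> 0 \<in> S \<and> (\<forall>x\<in>S. \<forall>y\<in>S. x - y \<in> S) \<and> dim S = 2"

definition haar_measure_on :: "(real ^ 2) set \<Rightarrow> (real ^ 2) measure \<Rightarrow> bool" where
  "haar_measure_on S m \<longleftrightarrow> sets m = sets borel \<and>
     emeasure m (UNIV - S) = 0 \<and> emeasure m S \<noteq> 0 \<and>
     (\<forall>C. compact C \<longrightarrow> emeasure m C < \<infinity>) \<and>
     (\<forall>g\<in>S. \<forall>A\<in>sets borel. emeasure m ((\<lambda>x. x + g) ` A) = emeasure m A)"

definition harris_recurrent :: "'x measure \<Rightarrow> ('x \<Rightarrow> 'x mrw_state measure) \<Rightarrow> 'x measure \<Rightarrow> bool" where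
  "harris_recurrent M K \<pi> \<longleftrightarrow>
     (\<forall>B \<in> sets M. measure \<pi> B > 0 \<longrightarrow> (\<forall>x \<in> space M.
        measure (mrw_law M K (return M x))
          {\<omega> \<in> space (mrw_law M K (return M x)). \<exists>\<^sub>\<infinity>k. fst (\<omega> k) \<in> B} = 1))"

end

theory Submission
  imports Defs
begin

text \<open>
  Last exit decomposition: if \<open>f\<^sub>N x\<close> is the probability, starting from \<open>(x, 0)\<close>, of staying outside
  the ball of radius \<open>2\<epsilon>\<close> around 0 from time \<open>N\<close> on, then the Markov property bounds
  \<open>\<Sum>\<^sub>n E\<^sub>\<pi>[f\<^sub>N(X\<^sub>n) 1\<^sub>B(S\<^sub>n)]\<close> with \<open>B = B(0, \<epsilon>)\<close> by \<open>N\<close>, since a path can be in \<open>B\<close> and then avoid it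
  after \<open>N\<close> further steps at no more than \<open>N\<close> times. The local limit hypothesis and the divergence
  of \<open>\<Sum> a\<^sub>n\<close> force \<open>\<pi>(f\<^sub>N) = 0\<close>, so 0 is recurrent from \<open>\<pi>\<close>-almost every point.
  Given \<open>s\<close> in the subgroup, almost every path which is near \<open>-s\<close> at time \<open>n\<close> comes back to 0 infinitely
  often, so the walk restarted at time \<open>n\<close> is near \<open>s\<close> infinitely often. By the local limit
  hypothesis on \<open>B(-s, \<epsilon>)\<close> this holds for the walk started at \<open>\<pi>\<close>-almost every point.
  Harris recurrence brings the chain from an arbitrary point into the set of such good points.
\<close>

section \<open>Laws of Markov chains on path space\<close>

text \<open>
  Testing the one-step property on boxes only keeps it stable under shifts, translations and
  mixtures, and still determines the law from its initial distribution.
\<close>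

definition markov_law :: "'a measure \<Rightarrow> ('a \<Rightarrow> 'a measure) \<Rightarrow> (nat \<Rightarrow> 'a) measure \<Rightarrow> bool" where
  "markov_law N \<kappa> P \<longleftrightarrow> prob_space P \<and> sets P = sets (\<Pi>\<^sub>M i\<in>UNIV. N) \<and>
     (\<forall>n A v. (\<forall>i. A i \<in> sets N) \<longrightarrow> v \<in> borel_measurable N \<longrightarrow>
       (\<integral>\<^sup>+\<omega>. (\<Prod>i\<le>n. indicator (A i) (\<omega> i)) * v (\<omega> (Suc n)) \<partial>P) =
       (\<integral>\<^sup>+\<omega>. (\<Prod>i\<le>n. indicator (A i) (\<omega> i)) * (\<integral>\<^sup>+y. v y \<partial>\<kappa> (\<omega> n)) \<partial>P))"

text \<open>Integrates the coordinates of the box out backwards, so that only the initial point remains.\<close>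

primrec box_value ::
  "('a \<Rightarrow> 'a measure) \<Rightarrow> (nat \<Rightarrow> 'a set) \<Rightarrow> nat \<Rightarrow> ('a \<Rightarrow> ennreal) \<Rightarrow> 'a \<Rightarrow> ennreal" where
  "box_value \<kappa> A 0 u = (\<lambda>z. indicator (A 0) z * u z)"
| "box_value \<kappa> A (Suc n) u = box_value \<kappa> A n (\<lambda>z. \<integral>\<^sup>+y. indicator (A (Suc n)) y * u y \<partial>\<kappa> z)"

section \<open>Boxes and uniqueness of a Markov law with given initial distribution\<close>

context
  fixes N :: "'a measure" and \<kappa> :: "'a \<Rightarrow> 'a measure"
  assumes \<kappa>[measurable]: "\<kappa> \<in> N \<rightarrow>\<^sub>M prob_algebra N"
begin

lemma markov_lawD:
  assumes "markov_law N \<kappa> P"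
  shows "prob_space P" "sets P = sets (\<Pi>\<^sub>M i\<in>UNIV. N)" "space P = space (\<Pi>\<^sub>M i\<in>UNIV. N)"
    "P \<in> space (prob_algebra (\<Pi>\<^sub>M i\<in>UNIV. N))"
proof -
  show *: "prob_space P" "sets P = sets (\<Pi>\<^sub>M i\<in>UNIV. N)"
    using assms by (auto simp: markov_law_def)
  show "P \<in> space (prob_algebra (\<Pi>\<^sub>M i\<in>UNIV. N))"
    using * by (simp add: space_prob_algebra)
  show "space P = space (\<Pi>\<^sub>M i\<in>UNIV. N)"
    using *(2) by (rule sets_eq_imp_space_eq)
qed

lemma measurable_kernel_nn_integral[measurable (raw)]:
  assumes "v \<in> borel_measurable N"
  shows "(\<lambda>z. \<integral>\<^sup>+y. v y \<partial>\<kappa> z) \<in> borel_measurable N"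
  by (rule measurable_compose[OF measurable_prob_algebraD[OF \<kappa>]
      nn_integral_measurable_subprob_algebra[OF assms]])

lemma measurable_path_kernel_nn_integral:
  fixes n :: nat
  assumes "v \<in> borel_measurable N"
  shows "(\<lambda>\<omega>. \<integral>\<^sup>+y. v y \<partial>\<kappa> (\<omega> n)) \<in> borel_measurable (\<Pi>\<^sub>M i\<in>UNIV. N)"
proof (rule measurable_compose[where f="\<lambda>\<omega>. \<omega> n" and N=N])
  show "(\<lambda>\<omega>. \<omega> n) \<in> (\<Pi>\<^sub>M i\<in>UNIV. N) \<rightarrow>\<^sub>M N" by measurable
qed (rule measurable_kernel_nn_integral[OF assms])

lemma measurable_box_value[measurable]:
  assumes [measurable]: "\<And>i. A i \<in> sets N" "u \<in> borel_measurable N"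
  shows "box_value \<kappa> A n u \<in> borel_measurable N"
  using assms(2)
proof (induction n arbitrary: u)
  case (Suc n)
  note Suc.prems[measurable]
  show ?case
    unfolding box_value.simps by (rule Suc.IH) measurable
qed simp

text \<open>The one-step property integrates out the last coordinate of the box; the resulting
  function of the coordinate before it becomes the new \<open>u\<close>, which is why the induction
  leaves \<open>u\<close> arbitrary.\<close>

lemma markov_law_nn_integral_box:
  assumes P: "markov_law N \<kappa> P" and A[measurable]: "\<And>i. A i \<in> sets N"
    and "u \<in> borel_measurable N"
  shows "(\<integral>\<^sup>+\<omega>. (\<Prod>i\<le>n. indicator (A i) (\<omega> i)) * u (\<omega> n) \<partial>P) =
    (\<integral>\<^sup>+\<omega>. box_value \<kappa> A n u (\<omega> 0) \<partial>P)"
  using assms(3)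
proof (induction n arbitrary: u)
  case (Suc n)
  note Suc.prems[measurable]
  have "(\<integral>\<^sup>+\<omega>. (\<Prod>i\<le>Suc n. indicator (A i) (\<omega> i)) * u (\<omega> (Suc n)) \<partial>P) =
      (\<integral>\<^sup>+\<omega>. (\<Prod>i\<le>n. indicator (A i) (\<omega> i)) * (indicator (A (Suc n)) (\<omega> (Suc n)) * u (\<omega> (Suc n))) \<partial>P)"
    by (simp add: mult_ac)
  also have "\<dots> = (\<integral>\<^sup>+\<omega>. (\<Prod>i\<le>n. indicator (A i) (\<omega> i)) *
      (\<integral>\<^sup>+y. indicator (A (Suc n)) y * u y \<partial>\<kappa> (\<omega> n)) \<partial>P)"
  proof -
    have "(\<lambda>y. indicator (A (Suc n)) y * u y) \<in> borel_measurable N"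
      by measurable
    then show ?thesis
      using P A unfolding markov_law_def by blast
  qed
  also have "\<dots> = (\<integral>\<^sup>+\<omega>. box_value \<kappa> A (Suc n) u (\<omega> 0) \<partial>P)"
    unfolding box_value.simps by (rule Suc.IH) measurable
  finally show ?case .
qed simp

text \<open>Coordinates up to a bound of \<open>J\<close> that are missing from \<open>J\<close> are
  filled with the whole space. Boxes over initial segments therefore cover all finite cylinders, and
  these determine a finite measure on the product.\<close>

lemma prod_emb_eq_box:
  assumes "finite J" "\<forall>i::nat\<in>J. A i \<in> sets N"
  shows "\<exists>A' n. (\<forall>i. A' i \<in> sets N) \<and>
    prod_emb UNIV (\<lambda>_. N) J (Pi\<^sub>E J A) = {\<omega> \<in> space (\<Pi>\<^sub>M i\<in>UNIV. N). \<forall>i\<le>n. \<omega> i \<in> A' i}"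
proof -
  obtain n where n: "\<forall>i\<in>J. i \<le> n"
    using assms(1) finite_nat_set_iff_bounded_le by auto
  define A' where "A' i = (if i \<in> J then A i else space N)" for i
  have "\<forall>i. A' i \<in> sets N" using assms by (auto simp: A'_def)
  moreover have "prod_emb UNIV (\<lambda>_. N) J (Pi\<^sub>E J A) = {\<omega> \<in> space (\<Pi>\<^sub>M i\<in>UNIV. N). \<forall>i\<le>n. \<omega> i \<in> A' i}"
    using n by (auto simp: prod_emb_def A'_def space_PiM PiE_iff split: if_splits)
  ultimately show ?thesis by blast
qed

text \<open>The right-hand side sees \<open>P\<close> only through its initial distribution; this is
  the source of uniqueness.\<close>

lemma markov_law_emeasure_box:
  assumes P: "markov_law N \<kappa> P" and A[measurable]: "\<And>i. A i \<in> sets N"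
  shows "emeasure P {\<omega> \<in> space (\<Pi>\<^sub>M i\<in>UNIV. N). \<forall>i\<le>n. \<omega> i \<in> A i} =
    (\<integral>\<^sup>+z. box_value \<kappa> A n (\<lambda>_. 1) z \<partial>distr P N (\<lambda>\<omega>. \<omega> 0))"
proof -
  note [measurable_cong] = markov_lawD(2)[OF P]
  have "emeasure P {\<omega> \<in> space (\<Pi>\<^sub>M i\<in>UNIV. N). \<forall>i\<le>n. \<omega> i \<in> A i} =
     (\<integral>\<^sup>+\<omega>. indicator {\<omega> \<in> space (\<Pi>\<^sub>M i\<in>UNIV. N). \<forall>i\<le>n. \<omega> i \<in> A i} \<omega> \<partial>P)"
    by (rule nn_integral_indicator[symmetric]) measurable
  also have "\<dots> = (\<integral>\<^sup>+\<omega>. (\<Prod>i\<le>n. indicator (A i) (\<omega> i)) * 1 \<partial>P)"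
  proof (rule nn_integral_cong)
    fix \<omega> assume "\<omega> \<in> space P"
    then show "indicator {\<omega> \<in> space (\<Pi>\<^sub>M i\<in>UNIV. N). \<forall>i\<le>n. \<omega> i \<in> A i} \<omega> =
        (\<Prod>i\<le>n. indicator (A i) (\<omega> i)) * (1::ennreal)"
      by (auto simp: markov_lawD(3)[OF P] indicator_def intro!: prod.neutral)
  qed
  also have "\<dots> = (\<integral>\<^sup>+\<omega>. box_value \<kappa> A n (\<lambda>_. 1) (\<omega> 0) \<partial>P)"
    by (rule markov_law_nn_integral_box[OF P A]) simp_all
  also have "\<dots> = (\<integral>\<^sup>+z. box_value \<kappa> A n (\<lambda>_. 1) z \<partial>distr P N (\<lambda>\<omega>. \<omega> 0))"
    by (rule nn_integral_distr[symmetric]) measurable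
  finally show ?thesis .
qed

lemma markov_law_eqI:
  assumes P: "markov_law N \<kappa> P" and Q: "markov_law N \<kappa> Q"
    and init: "distr P N (\<lambda>\<omega>. \<omega> 0) = distr Q N (\<lambda>\<omega>. \<omega> 0)"
  shows "P = Q"
proof (rule measure_eqI_PiM_infinite)
  show "finite_measure P"
    using markov_lawD(1)[OF P] by (simp add: prob_space.finite_measure)
  fix A and J :: "nat set" assume "finite J" and "\<And>i. i \<in> J \<Longrightarrow> A i \<in> sets N"
  then have "finite J" "\<forall>i\<in>J. A i \<in> sets N" by auto
  from prod_emb_eq_box[OF this] obtain A' n where "\<forall>i. A' i \<in> sets N"
    and eq: "prod_emb UNIV (\<lambda>_. N) J (Pi\<^sub>E J A) = {\<omega> \<in> space (\<Pi>\<^sub>M i\<in>UNIV. N). \<forall>i\<le>n. \<omega> i \<in> A' i}"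
    by (elim exE conjE)
  then have A': "\<And>i. A' i \<in> sets N" by simp
  show "emeasure P (prod_emb UNIV (\<lambda>_. N) J (Pi\<^sub>E J A)) = emeasure Q (prod_emb UNIV (\<lambda>_. N) J (Pi\<^sub>E J A))"
    unfolding eq markov_law_emeasure_box[OF P A'] markov_law_emeasure_box[OF Q A'] init ..
qed (use markov_lawD[OF P] markov_lawD[OF Q] in auto)

lemma measurable_path_shift:
  assumes P: "markov_law N \<kappa> P"
  shows "(\<lambda>\<omega> i. \<omega> (k + i)) \<in> P \<rightarrow>\<^sub>M (\<Pi>\<^sub>M i\<in>UNIV. N)"
proof -
  note [measurable_cong] = markov_lawD(2)[OF P]
  show ?thesis
    by (rule measurable_PiM_single') (auto simp: markov_lawD(3)[OF P] space_PiM)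
qed

lemma markov_law_shift:
  assumes P: "markov_law N \<kappa> P"
  shows "markov_law N \<kappa> (distr P (\<Pi>\<^sub>M i\<in>UNIV. N) (\<lambda>\<omega> i. \<omega> (k + i)))"
proof -
  note [measurable_cong] = markov_lawD(2)[OF P]
  note shift = measurable_path_shift[OF P]
  have "(\<integral>\<^sup>+\<omega>. (\<Prod>i\<le>n. indicator (A i) (\<omega> i)) * v (\<omega> (Suc n)) \<partial>distr P (\<Pi>\<^sub>M i\<in>UNIV. N) (\<lambda>\<omega> i. \<omega> (k + i))) =
      (\<integral>\<^sup>+\<omega>. (\<Prod>i\<le>n. indicator (A i) (\<omega> i)) * (\<integral>\<^sup>+y. v y \<partial>\<kappa> (\<omega> n)) \<partial>distr P (\<Pi>\<^sub>M i\<in>UNIV. N) (\<lambda>\<omega> i. \<omega> (k + i)))"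
    if A[measurable]: "\<And>i. A i \<in> sets N" and v[measurable]: "v \<in> borel_measurable N" for n A v
  proof -
    note measurable_path_kernel_nn_integral[OF v, measurable]
    \<comment> \<open>The box is padded with \<open>k\<close> trivial coordinates, so that the
      one-step property of \<open>P\<close> at time \<open>k + n\<close> applies.\<close>
    define A' where "A' i = (if i < k then space N else A (i - k))" for i
    have A': "A' i \<in> sets N" for i by (auto simp: A'_def)
    have *: "(\<Prod>i\<le>n. indicator (A i) (\<omega> (k + i))) = (\<Prod>i\<le>k+n. indicator (A' i) (\<omega> i) :: ennreal)"
      if "\<omega> \<in> space P" for \<omega>
    proof -
      have "(\<Prod>i\<le>k+n. indicator (A' i) (\<omega> i) :: ennreal) = (\<Prod>i\<in>{k..k+n}. indicator (A' i) (\<omega> i))"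
        using that by (intro prod.mono_neutral_right)
          (auto simp: A'_def markov_lawD(3)[OF P] space_PiM PiE_iff)
      also have "\<dots> = (\<Prod>i\<in>{0..n}. indicator (A' (i + k)) (\<omega> (i + k)))"
        using prod.shift_bounds_cl_nat_ivl[of "\<lambda>i. indicator (A' i) (\<omega> i) :: ennreal" 0 k n]
        by (simp add: add.commute)
      finally show ?thesis
        by (simp add: A'_def add.commute atMost_atLeast0)
    qed
    have "(\<integral>\<^sup>+\<omega>. (\<Prod>i\<le>n. indicator (A i) (\<omega> i)) * v (\<omega> (Suc n)) \<partial>distr P (\<Pi>\<^sub>M i\<in>UNIV. N) (\<lambda>\<omega> i. \<omega> (k + i))) =
        (\<integral>\<^sup>+\<omega>. (\<Prod>i\<le>k+n. indicator (A' i) (\<omega> i)) * v (\<omega> (Suc (k + n))) \<partial>P)"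
      by (subst nn_integral_distr[OF shift]) (measurable, auto simp: * intro!: nn_integral_cong)
    also have "\<dots> = (\<integral>\<^sup>+\<omega>. (\<Prod>i\<le>k+n. indicator (A' i) (\<omega> i)) * (\<integral>\<^sup>+y. v y \<partial>\<kappa> (\<omega> (k + n))) \<partial>P)"
      using P A' v unfolding markov_law_def by blast
    also have "\<dots> = (\<integral>\<^sup>+\<omega>. (\<Prod>i\<le>n. indicator (A i) (\<omega> i)) * (\<integral>\<^sup>+y. v y \<partial>\<kappa> (\<omega> n)) \<partial>distr P (\<Pi>\<^sub>M i\<in>UNIV. N) (\<lambda>\<omega> i. \<omega> (k + i)))"
      by (subst nn_integral_distr[OF shift]) (measurable, auto simp: * intro!: nn_integral_cong)
    finally show ?thesis .
  qed
  then show ?thesis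
    unfolding markov_law_def
    by (auto intro!: prob_space.prob_space_distr markov_lawD(1)[OF P] shift)
qed

section \<open>Families of laws indexed by the starting point, and the Markov property\<close>

context
  fixes L :: "'a \<Rightarrow> (nat \<Rightarrow> 'a) measure"
  assumes L: "\<And>z. z \<in> space N \<Longrightarrow> markov_law N \<kappa> (L z)"
    and L_init: "\<And>z. z \<in> space N \<Longrightarrow> distr (L z) N (\<lambda>\<omega>. \<omega> 0) = return N z"
begin

text \<open>Measurability in the starting point comes for free: the probability of a box is
  \<open>box_value\<close> evaluated at \<open>z\<close>, a measurable function, and the cylinders
  are an intersection-stable generator.\<close>

lemma measurable_markov_family[measurable]: "L \<in> N \<rightarrow>\<^sub>M prob_algebra (\<Pi>\<^sub>M i\<in>UNIV. N)"
proof (rule measurable_prob_algebra_generated[OF sets_PiM Int_stable_prod_algebra prod_algebra_sets_into_space])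
  fix X assume "X \<in> prod_algebra UNIV (\<lambda>_::nat. N)"
  then obtain J A where "finite J" "\<forall>i\<in>J. A i \<in> sets N"
    and X: "X = prod_emb UNIV (\<lambda>_. N) J (Pi\<^sub>E J A)"
    by (elim prod_algebraE) auto
  from prod_emb_eq_box[OF this(1,2)] obtain A' n where "\<forall>i. A' i \<in> sets N"
    and eq: "prod_emb UNIV (\<lambda>_. N) J (Pi\<^sub>E J A) = {\<omega> \<in> space (\<Pi>\<^sub>M i\<in>UNIV. N). \<forall>i\<le>n. \<omega> i \<in> A' i}"
    by (elim exE conjE)
  then have A': "\<And>i. A' i \<in> sets N" by simp
  have [measurable]: "box_value \<kappa> A' n (\<lambda>_. 1) \<in> borel_measurable N"
    by (rule measurable_box_value[OF A']) simp
  have "emeasure (L z) X = box_value \<kappa> A' n (\<lambda>_. 1) z" if z: "z \<in> space N" for z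
    unfolding X eq markov_law_emeasure_box[OF L[OF z] A'] L_init[OF z]
    by (rule nn_integral_return[OF z]) measurable
  then show "(\<lambda>z. emeasure (L z) X) \<in> borel_measurable N"
    by (subst measurable_cong) auto
qed (use L markov_lawD in auto)

text \<open>For each box and each \<open>v\<close> the one-step identity equates two integrals
  against the law, so it survives averaging over the starting point.\<close>

lemma markov_law_mixture:
  assumes \<nu>: "prob_space \<nu>" "sets \<nu> = sets N"
  shows "markov_law N \<kappa> (\<nu> \<bind> L)" "distr (\<nu> \<bind> L) N (\<lambda>\<omega>. \<omega> 0) = \<nu>"
proof -
  have [measurable]: "L \<in> \<nu> \<rightarrow>\<^sub>M prob_algebra (\<Pi>\<^sub>M i\<in>UNIV. N)"
    using measurable_markov_family by (simp add: measurable_cong_sets[OF \<nu>(2) refl])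
  have sub: "L \<in> \<nu> \<rightarrow>\<^sub>M subprob_algebra (\<Pi>\<^sub>M i\<in>UNIV. N)"
    by (rule measurable_prob_algebraD) measurable
  have sp: "space \<nu> = space N" using \<nu>(2) by (rule sets_eq_imp_space_eq)
  have ne: "space \<nu> \<noteq> {}" using \<nu>(1) by (rule prob_space.not_empty)
  have sets: "sets (\<nu> \<bind> L) = sets (\<Pi>\<^sub>M i\<in>UNIV. N)"
    using ne L markov_lawD(2) sp by (intro sets_bind) auto
  have "(\<integral>\<^sup>+\<omega>. (\<Prod>i\<le>n. indicator (A i) (\<omega> i)) * v (\<omega> (Suc n)) \<partial>(\<nu> \<bind> L)) =
      (\<integral>\<^sup>+\<omega>. (\<Prod>i\<le>n. indicator (A i) (\<omega> i)) * (\<integral>\<^sup>+y. v y \<partial>\<kappa> (\<omega> n)) \<partial>(\<nu> \<bind> L))"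
    if A[measurable]: "\<And>i. A i \<in> sets N" and v[measurable]: "v \<in> borel_measurable N" for n A v
  proof -
    have "(\<integral>\<^sup>+\<omega>. (\<Prod>i\<le>n. indicator (A i) (\<omega> i)) * v (\<omega> (Suc n)) \<partial>L z) =
        (\<integral>\<^sup>+\<omega>. (\<Prod>i\<le>n. indicator (A i) (\<omega> i)) * (\<integral>\<^sup>+y. v y \<partial>\<kappa> (\<omega> n)) \<partial>L z)"
      if "z \<in> space \<nu>" for z
      using L[of z] that A v unfolding markov_law_def sp by blast
    moreover have "(\<lambda>\<omega>. (\<Prod>i\<le>n. indicator (A i) (\<omega> i)) * v (\<omega> (Suc n)))
        \<in> borel_measurable (\<Pi>\<^sub>M i\<in>UNIV. N)"
      by measurable
    moreover have "(\<lambda>\<omega>. (\<Prod>i\<le>n. indicator (A i) (\<omega> i)) * (\<integral>\<^sup>+y. v y \<partial>\<kappa> (\<omega> n)))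
        \<in> borel_measurable (\<Pi>\<^sub>M i\<in>UNIV. N)"
      using measurable_path_kernel_nn_integral[OF v, measurable] by measurable
    ultimately show ?thesis
      by (simp add: nn_integral_bind[OF _ sub] cong: nn_integral_cong)
  qed
  moreover have "prob_space (\<nu> \<bind> L)"
    using \<nu>(1) sub L markov_lawD(1) sp by (intro prob_space.prob_space_bind) auto
  ultimately show "markov_law N \<kappa> (\<nu> \<bind> L)"
    unfolding markov_law_def using sets by blast
  have "distr (\<nu> \<bind> L) N (\<lambda>\<omega>. \<omega> 0) = \<nu> \<bind> (\<lambda>z. distr (L z) N (\<lambda>\<omega>. \<omega> 0))"
    by (rule distr_bind[OF sub ne]) measurable
  also have "\<dots> = \<nu> \<bind> return N"
    using L_init sp by (intro bind_cong) auto
  also have "\<dots> = \<nu>" using \<nu>(2) by (rule bind_return'')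
  finally show "distr (\<nu> \<bind> L) N (\<lambda>\<omega>. \<omega> 0) = \<nu>" .
qed

text \<open>The law of the path shifted by \<open>k\<close> and the mixture of \<open>L\<close> over
  the law of the \<open>k\<close>-th coordinate are both Markov laws with the same initial
  distribution, so uniqueness identifies them.\<close>

lemma markov_property:
  assumes P: "markov_law N \<kappa> P" and F[measurable]: "F \<in> sets (\<Pi>\<^sub>M i\<in>UNIV. N)"
  shows "emeasure P {\<omega> \<in> space P. (\<lambda>i. \<omega> (k + i)) \<in> F} = (\<integral>\<^sup>+\<omega>. emeasure (L (\<omega> k)) F \<partial>P)"
proof -
  note [measurable_cong] = markov_lawD(2)[OF P]
  note shift = measurable_path_shift[OF P]
  have comp: "(\<lambda>\<omega>. \<omega> j) \<in> P \<rightarrow>\<^sub>M N" for j by measurable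
  let ?Q = "distr P (\<Pi>\<^sub>M i\<in>UNIV. N) (\<lambda>\<omega> i. \<omega> (k + i))" and ?\<nu> = "distr P N (\<lambda>\<omega>. \<omega> k)"
  have \<nu>: "prob_space ?\<nu>" "sets ?\<nu> = sets N"
    by (auto intro!: prob_space.prob_space_distr markov_lawD(1)[OF P] comp)
  have "distr ?Q N (\<lambda>\<omega>. \<omega> 0) = ?\<nu>"
    by (subst distr_distr[OF _ shift]) (auto simp: comp_def)
  then have Q: "?Q = ?\<nu> \<bind> L"
    using markov_law_mixture[OF \<nu>] by (intro markov_law_eqI markov_law_shift P) simp_all
  have "emeasure P {\<omega> \<in> space P. (\<lambda>i. \<omega> (k + i)) \<in> F} = emeasure ?Q F"
    by (subst emeasure_distr[OF shift F]) (auto intro!: arg_cong[where f="emeasure P"])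
  also have "\<dots> = (\<integral>\<^sup>+z. emeasure (L z) F \<partial>?\<nu>)"
    unfolding Q using \<nu>
    by (intro emeasure_bind_prob_algebra[OF _ measurable_markov_family F])
      (auto simp: space_prob_algebra)
  also have "\<dots> = (\<integral>\<^sup>+\<omega>. emeasure (L (\<omega> k)) F \<partial>P)"
    by (rule nn_integral_distr[OF comp])
      (simp add: measurable_compose[OF measurable_prob_algebraD[OF measurable_markov_family]
          measurable_emeasure_subprob_algebra[OF F]])
  finally show ?thesis .
qed

end

end

text \<open>The integrand on the left depends on the coordinates up to \<open>n\<close> only. On
  these the limit is the \<open>n\<close>-fold composition of kernels followed by one more draw from
  \<open>P n\<close>, which can be integrated out first.\<close>

lemma (in Ionescu_Tulcea) nn_integral_lim_step:
  assumes f[measurable]: "f \<in> borel_measurable (PiM {0..<n} M)" and v[measurable]: "v \<in> borel_measurable (M n)"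
  shows "(\<integral>\<^sup>+\<omega>. f (restrict \<omega> {0..<n}) * v (\<omega> n) \<partial>PF.lim) =
    (\<integral>\<^sup>+\<omega>. f (restrict \<omega> {0..<n}) * (\<integral>\<^sup>+y. v y \<partial>P n (restrict \<omega> {0..<n})) \<partial>PF.lim)"
proof -
  \<comment> \<open>On an initial segment the projective family is the composition of the first
    \<open>k\<close> kernels itself: the bound \<open>up_to\<close> is exactly \<open>k\<close>, and
    the restriction inside \<open>CI\<close> changes nothing.\<close>
  have CI_eq: "CI {0..<k} = C 0 k (\<lambda>x. undefined)" for k
  proof -
    have up: "up_to {0..<k} = k"
      by (auto intro!: antisym simp: up_to_iff not_less_eq_eq dest: up_to_less[of "{0..<k}" "k - 1"])
        (metis atLeastLessThan_iff finite_atLeastLessThan le0 less_irrefl linorder_not_less up_to_less)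
    have "distr (C 0 k (\<lambda>x. undefined)) (PiM {0..<k} M) (\<lambda>f. restrict f {0..<k}) =
        distr (C 0 k (\<lambda>x. undefined)) (PiM {0..<0+k} M) (\<lambda>f. restrict f {0..<0+k})"
      by simp
    also have "\<dots> = C 0 k (\<lambda>x. undefined)"
      by (rule distr_C[symmetric]) auto
    finally show ?thesis by (simp add: CI_def up)
  qed
  have *: "distr PF.lim (PiM {0..<k} M) (\<lambda>x. restrict x {0..<k}) = C 0 k (\<lambda>x. undefined)" for k
    by (simp add: distr_lim CI_eq)
  have r[measurable]: "(\<lambda>x. restrict x {0..<k}) \<in> PF.lim \<rightarrow>\<^sub>M PiM {0..<k} M" for k
    by (subst measurable_cong_sets[OF PF.sets_lim refl]) (rule measurable_restrict_subset, simp)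
  have rest[measurable]: "(\<lambda>x. restrict x {0..<n}) \<in> PiM {0..<Suc n} M \<rightarrow>\<^sub>M PiM {0..<n} M"
    by (rule measurable_restrict_subset) auto
  have [measurable]: "(\<lambda>x. x n) \<in> PiM {0..<Suc n} M \<rightarrow>\<^sub>M M n"
    by (rule measurable_component_singleton) simp
  have u: "(\<lambda>x. undefined) \<in> space (PiM {0..<0} M)" by simp
  have "(\<integral>\<^sup>+\<omega>. f (restrict \<omega> {0..<n}) * v (\<omega> n) \<partial>PF.lim) =
    (\<integral>\<^sup>+\<omega>. f (restrict \<omega> {0..<n}) * v (\<omega> n) \<partial>distr PF.lim (PiM {0..<Suc n} M) (\<lambda>x. restrict x {0..<Suc n}))"
    by (subst nn_integral_distr) (auto simp: restrict_restrict Int_absorb1 min_def)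
  also have "\<dots> = (\<integral>\<^sup>+\<omega>. f (restrict \<omega> {0..<n}) * v (\<omega> n) \<partial>(C 0 n (\<lambda>x. undefined) \<bind> eP n))"
    unfolding * by simp
  also have "\<dots> = (\<integral>\<^sup>+\<omega>. \<integral>\<^sup>+\<omega>'. f (restrict \<omega>' {0..<n}) * v (\<omega>' n) \<partial>eP n \<omega> \<partial>C 0 n (\<lambda>x. undefined))"
    using measurable_eP[of n] sets_C[OF u, of n]
    by (intro nn_integral_bind[where B="PiM {0..<Suc n} M"]) (auto simp: measurable_cong_sets[OF sets_C[OF u] refl])
  also have "\<dots> = (\<integral>\<^sup>+\<omega>. f \<omega> * (\<integral>\<^sup>+y. v y \<partial>P n \<omega>) \<partial>C 0 n (\<lambda>x. undefined))"
  proof (rule nn_integral_cong)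
    fix \<omega> assume "\<omega> \<in> space (C 0 n (\<lambda>x. undefined))"
    then have \<omega>: "\<omega> \<in> space (PiM {0..<n} M)" by (simp add: space_C)
    \<comment> \<open>The kernel \<open>eP n\<close> only appends a coordinate, so the factor
      depending on the history is constant in the inner integral.\<close>
    then have res: "restrict (fun_upd \<omega> n y) {0..<n} = \<omega>" for y
      by (auto simp: space_PiM PiE_iff extensional_def restrict_def fun_eq_iff)
    have vm: "v \<in> borel_measurable (P n \<omega>)"
      using v by (simp add: measurable_cong_sets[OF sets_P[OF \<omega>] refl])
    show "(\<integral>\<^sup>+\<omega>'. f (restrict \<omega>' {0..<n}) * v (\<omega>' n) \<partial>eP n \<omega>) = f \<omega> * (\<integral>\<^sup>+y. v y \<partial>P n \<omega>)"
      by (subst nn_integral_eP[OF \<omega>]) (simp_all del: restrict_apply add: res nn_integral_cmult[OF vm])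
  qed
  also have "\<dots> = (\<integral>\<^sup>+\<omega>. f \<omega> * (\<integral>\<^sup>+y. v y \<partial>P n \<omega>) \<partial>distr PF.lim (PiM {0..<n} M) (\<lambda>x. restrict x {0..<n}))"
    unfolding * ..
  also have "\<dots> = (\<integral>\<^sup>+\<omega>. f (restrict \<omega> {0..<n}) * (\<integral>\<^sup>+y. v y \<partial>P n (restrict \<omega> {0..<n})) \<partial>PF.lim)"
    by (rule nn_integral_distr[OF r])
      (auto intro!: borel_measurable_times measurable_compose[OF P nn_integral_measurable_subprob_algebra])
  finally show ?thesis .
qed

section \<open>The Markov property of the Markov random walk\<close>

text \<open>The full kernel P((x,s); .) recovered from \<open>K\<close> by translation invariance.
  It agrees with \<open>mrw_step\<close> at every positive time, which makes the walk a homogeneous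
  chain on the state space.\<close>

definition mrw_kernel ::
  "'x measure \<Rightarrow> ('x \<Rightarrow> 'x mrw_state measure) \<Rightarrow> 'x mrw_state \<Rightarrow> 'x mrw_state measure" where
  "mrw_kernel M K z = distr (K (fst z)) (M \<Otimes>\<^sub>M borel) (\<lambda>y. (fst y, snd z + snd y))"

definition translate :: "real ^ 2 \<Rightarrow> (nat \<Rightarrow> 'x mrw_state) \<Rightarrow> nat \<Rightarrow> 'x mrw_state" where
  "translate s \<omega> = (\<lambda>i. (fst (\<omega> i), s + snd (\<omega> i)))"

lemma translate_measurable[measurable]:
  "translate s \<in> (\<Pi>\<^sub>M i\<in>UNIV. M \<Otimes>\<^sub>M borel) \<rightarrow>\<^sub>M (\<Pi>\<^sub>M i\<in>UNIV. M \<Otimes>\<^sub>M borel)"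
  unfolding translate_def by (rule measurable_PiM_single') (auto simp: space_PiM space_pair_measure PiE_iff mem_Times_iff)

locale mrw =
  fixes M :: "'x measure" and K :: "'x \<Rightarrow> 'x mrw_state measure"
  assumes K[measurable]: "K \<in> M \<rightarrow>\<^sub>M prob_algebra (M \<Otimes>\<^sub>M borel)"
begin

abbreviation states :: "'x mrw_state measure" where
  "states \<equiv> M \<Otimes>\<^sub>M borel"

abbreviation paths :: "(nat \<Rightarrow> 'x mrw_state) measure" where
  "paths \<equiv> \<Pi>\<^sub>M i\<in>UNIV. M \<Otimes>\<^sub>M borel"

lemma measurable_mrw_kernel: "mrw_kernel M K \<in> states \<rightarrow>\<^sub>M prob_algebra states"
  unfolding mrw_kernel_def[abs_def] by measurable

lemma Ionescu_Tulcea_mrw_step: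
  assumes \<mu>: "prob_space \<mu>" "sets \<mu> = sets M"
  shows "Ionescu_Tulcea (mrw_step M K \<mu>) (\<lambda>_. states)"
proof -
  have step: "mrw_step M K \<mu> i \<in> (\<Pi>\<^sub>M j\<in>{0..<i}. states) \<rightarrow>\<^sub>M prob_algebra states" for i
  proof (cases "i = 0")
    case True
    have "(\<lambda>x. (x, 0)) \<in> \<mu> \<rightarrow>\<^sub>M states"
      by (subst measurable_cong_sets[OF \<mu>(2) refl]) measurable
    then have "distr \<mu> states (\<lambda>x. (x, 0)) \<in> space (prob_algebra states)"
      using \<mu>(1) by (simp add: space_prob_algebra prob_space.prob_space_distr)
    then show ?thesis
      using True by (simp add: mrw_step_def[abs_def])
  next
    case False
    then have "(\<lambda>\<omega>. mrw_kernel M K (\<omega> (i - 1))) \<in>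
        (\<Pi>\<^sub>M j\<in>{0..<i}. states) \<rightarrow>\<^sub>M prob_algebra states"
      by (intro measurable_compose[where f="\<lambda>\<omega>. \<omega> (i - 1)", OF _ measurable_mrw_kernel]
          measurable_component_singleton) auto
    then show ?thesis
      using False by (simp add: mrw_step_def[abs_def] mrw_kernel_def case_prod_beta')
  qed
  show ?thesis
    unfolding Ionescu_Tulcea_def
    using measurable_prob_algebraD[OF step] measurable_space[OF step] by (simp add: space_prob_algebra)
qed

context
  fixes \<mu> :: "'x measure"
  assumes \<mu>: "prob_space \<mu>" "sets \<mu> = sets M"
begin

interpretation IT: Ionescu_Tulcea "mrw_step M K \<mu>" "\<lambda>_. states"
  using \<mu> by (rule Ionescu_Tulcea_mrw_step)

lemma distr_mrw_law_0:
  "distr (mrw_law M K \<mu>) states (\<lambda>\<omega>. \<omega> 0) = distr \<mu> states (\<lambda>x. (x, 0))"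
proof (rule measure_eqI)
  fix A assume "A \<in> sets (distr (mrw_law M K \<mu>) states (\<lambda>\<omega>. \<omega> 0))"
  then have A[measurable]: "A \<in> sets states" by simp
  have [measurable]: "(\<lambda>\<omega>. \<omega> 0) \<in> IT.PF.lim \<rightarrow>\<^sub>M states"
    by (subst measurable_cong_sets[OF IT.PF.sets_lim refl]) measurable
  \<comment> \<open>Total mass 1 is read off the projection to the empty index set; it is needed
    below to integrate a constant.\<close>
  interpret L: prob_space IT.PF.lim
  proof (rule prob_space_distrD)
    show "(\<lambda>\<omega>. restrict \<omega> {}) \<in> IT.PF.lim \<rightarrow>\<^sub>M (\<Pi>\<^sub>M i\<in>{}. states)"
      by (subst measurable_cong_sets[OF IT.PF.sets_lim refl]) (rule measurable_restrict_subset, simp)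
    show "prob_space (distr IT.PF.lim (\<Pi>\<^sub>M i\<in>{}. states) (\<lambda>\<omega>. restrict \<omega> {}))"
      unfolding IT.distr_lim[OF finite.emptyI] by (rule IT.PF.prob_space_P) auto
  qed
  have "emeasure (distr (mrw_law M K \<mu>) states (\<lambda>\<omega>. \<omega> 0)) A =
      (\<integral>\<^sup>+\<omega>. indicator A (\<omega> 0) \<partial>IT.PF.lim)"
    unfolding mrw_law_def
    by (subst nn_integral_indicator[symmetric], simp, subst nn_integral_distr) auto
  \<comment> \<open>The step formula at time 0 has an empty history. Since \<open>mrw_step\<close>
    at 0 ignores its path argument, a dummy path can be supplied.\<close>
  also have "\<dots> = (\<integral>\<^sup>+\<omega>. (\<integral>\<^sup>+y. indicator A y \<partial>mrw_step M K \<mu> 0 (\<lambda>_. undefined)) \<partial>IT.PF.lim)"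
    using IT.nn_integral_lim_step[of "\<lambda>_. 1" 0 "indicator A"] by (simp add: mrw_step_def)
  also have "\<dots> = emeasure (distr \<mu> states (\<lambda>x. (x, 0))) A"
    using L.emeasure_space_1 by (simp add: mrw_step_def)
  finally show "emeasure (distr (mrw_law M K \<mu>) states (\<lambda>\<omega>. \<omega> 0)) A =
      emeasure (distr \<mu> states (\<lambda>x. (x, 0))) A" .
qed simp

lemma prob_space_mrw_law: "prob_space (mrw_law M K \<mu>)"
proof (rule prob_space_distrD)
  show "(\<lambda>\<omega>. \<omega> 0) \<in> mrw_law M K \<mu> \<rightarrow>\<^sub>M states"
    unfolding mrw_law_def by (subst measurable_cong_sets[OF IT.PF.sets_lim refl]) measurable
  have "(\<lambda>x. (x, 0)) \<in> \<mu> \<rightarrow>\<^sub>M states"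
    by (subst measurable_cong_sets[OF \<mu>(2) refl]) measurable
  then show "prob_space (distr (mrw_law M K \<mu>) states (\<lambda>\<omega>. \<omega> 0))"
    unfolding distr_mrw_law_0 using \<mu>(1) by (rule prob_space.prob_space_distr[rotated])
qed

text \<open>The indicator of a box up to time \<open>n\<close> is a function of the history before
  time \<open>Suc n\<close>, and there \<open>mrw_step\<close> is \<open>mrw_kernel\<close> at the
  last state; so the step formula for the limit is the one-step property.\<close>

lemma markov_law_mrw_law: "markov_law states (mrw_kernel M K) (mrw_law M K \<mu>)"
proof -
  have "(\<integral>\<^sup>+\<omega>. (\<Prod>i\<le>n. indicator (A i) (\<omega> i)) * v (\<omega> (Suc n)) \<partial>mrw_law M K \<mu>) =
      (\<integral>\<^sup>+\<omega>. (\<Prod>i\<le>n. indicator (A i) (\<omega> i)) * (\<integral>\<^sup>+y. v y \<partial>mrw_kernel M K (\<omega> n)) \<partial>mrw_law M K \<mu>)"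
    if A[measurable]: "\<And>i. A i \<in> sets states" and v: "v \<in> borel_measurable states" for n A v
  proof -
    have "(\<lambda>\<omega>. \<Prod>i\<le>n. indicator (A i) (\<omega> i) :: ennreal) \<in>
        borel_measurable (\<Pi>\<^sub>M i\<in>{0..<Suc n}. states)"
    proof (rule borel_measurable_prod_ennreal)
      fix i assume "i \<in> {..n}"
      then have "(\<lambda>\<omega>. \<omega> i) \<in> (\<Pi>\<^sub>M i\<in>{0..<Suc n}. states) \<rightarrow>\<^sub>M states"
        by (intro measurable_component_singleton) auto
      then show "(\<lambda>\<omega>. indicator (A i) (\<omega> i) :: ennreal) \<in> borel_measurable (\<Pi>\<^sub>M i\<in>{0..<Suc n}. states)"
        by measurable
    qed
    from IT.nn_integral_lim_step[OF this v] show ?thesis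
      by (simp add: mrw_law_def mrw_step_def mrw_kernel_def case_prod_beta')
  qed
  then show ?thesis
    unfolding markov_law_def using prob_space_mrw_law
    by (auto simp: mrw_law_def)
qed

lemma sets_mrw_law: "sets (mrw_law M K \<mu>) = sets paths"
  and space_mrw_law: "space (mrw_law M K \<mu>) = space paths"
  by (rule markov_lawD[OF measurable_mrw_kernel markov_law_mrw_law])+

lemma mrw_law_AE_start: "AE \<omega> in mrw_law M K \<mu>. snd (\<omega> 0) = 0"
proof -
  have m: "(\<lambda>\<omega>. \<omega> 0) \<in> mrw_law M K \<mu> \<rightarrow>\<^sub>M states"
    by (subst measurable_cong_sets[OF sets_mrw_law refl]) measurable
  have i: "(\<lambda>x. (x, 0)) \<in> \<mu> \<rightarrow>\<^sub>M states"
    by (subst measurable_cong_sets[OF \<mu>(2) refl]) measurable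
  have "AE z in distr \<mu> states (\<lambda>x. (x, 0)). snd z = 0"
    by (subst AE_distr_iff[OF i]) auto
  then show ?thesis
    unfolding distr_mrw_law_0[symmetric] by (subst (asm) AE_distr_iff[OF m]) auto
qed

end

text \<open>Translation commutes with \<open>mrw_kernel\<close>, by associativity of addition.
  Pulling the boxes and \<open>v\<close> back along the translation reduces the one-step property to
  that of \<open>P\<close>.\<close>

lemma markov_law_translate:
  assumes P: "markov_law states (mrw_kernel M K) P"
  shows "markov_law states (mrw_kernel M K) (distr P paths (translate s))"
proof -
  note D = markov_lawD[OF measurable_mrw_kernel P]
  note [measurable_cong] = D(2)
  have t: "translate s \<in> P \<rightarrow>\<^sub>M paths"
    by (subst measurable_cong_sets[OF D(2) refl]) measurable
  let ?h = "\<lambda>z. (fst z, s + snd z) :: 'x mrw_state"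
  have "(\<integral>\<^sup>+\<omega>. (\<Prod>i\<le>n. indicator (A i) (\<omega> i)) * v (\<omega> (Suc n)) \<partial>distr P paths (translate s)) =
      (\<integral>\<^sup>+\<omega>. (\<Prod>i\<le>n. indicator (A i) (\<omega> i)) * (\<integral>\<^sup>+y. v y \<partial>mrw_kernel M K (\<omega> n)) \<partial>distr P paths (translate s))"
    if A[measurable]: "\<And>i. A i \<in> sets states" and v[measurable]: "v \<in> borel_measurable states" for n A v
  proof -
    note measurable_path_kernel_nn_integral[OF measurable_mrw_kernel v, measurable]
    define A' where "A' i = {z \<in> space states. ?h z \<in> A i}" for i
    have A': "A' i \<in> sets states" for i unfolding A'_def by measurable
    have v': "(\<lambda>z. v (?h z)) \<in> borel_measurable states" by measurable
    have *: "indicator (A i) (?h (\<omega> i)) = (indicator (A' i) (\<omega> i) :: ennreal)"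
      if "\<omega> \<in> space P" for \<omega> i
      using that unfolding D(3) by (auto simp: A'_def space_PiM PiE_iff indicator_def)
    have kernel: "(\<integral>\<^sup>+y. v y \<partial>mrw_kernel M K (?h z)) = (\<integral>\<^sup>+y. v (?h y) \<partial>mrw_kernel M K z)"
      if "z \<in> space states" for z
    proof -
      have "fst z \<in> space M" using that by (auto simp: space_pair_measure)
      then have "sets (K (fst z)) = sets states"
        using measurable_space[OF K] by (auto simp: space_prob_algebra)
      note [measurable_cong] = this
      have 1: "(\<lambda>y. (fst y, r + snd y)) \<in> K (fst z) \<rightarrow>\<^sub>M states" for r by measurable
      show ?thesis
        unfolding mrw_kernel_def fst_conv snd_conv
        by (subst (1 2) nn_integral_distr[OF 1]) (simp_all add: add.assoc v v')
    qed
    have "(\<integral>\<^sup>+\<omega>. (\<Prod>i\<le>n. indicator (A i) (\<omega> i)) * v (\<omega> (Suc n)) \<partial>distr P paths (translate s)) =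
        (\<integral>\<^sup>+\<omega>. (\<Prod>i\<le>n. indicator (A' i) (\<omega> i)) * v (?h (\<omega> (Suc n))) \<partial>P)"
      by (subst nn_integral_distr[OF t]) (measurable, auto simp: * translate_def intro!: nn_integral_cong)
    also have "\<dots> = (\<integral>\<^sup>+\<omega>. (\<Prod>i\<le>n. indicator (A' i) (\<omega> i)) * (\<integral>\<^sup>+y. v (?h y) \<partial>mrw_kernel M K (\<omega> n)) \<partial>P)"
      using P A' v' unfolding markov_law_def by blast
    also have "\<dots> = (\<integral>\<^sup>+\<omega>. (\<Prod>i\<le>n. indicator (A' i) (\<omega> i)) * (\<integral>\<^sup>+y. v y \<partial>mrw_kernel M K (?h (\<omega> n))) \<partial>P)"
      by (intro nn_integral_cong arg_cong2[where f="(*)"] kernel[symmetric] refl)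
        (auto simp: D(3) space_PiM PiE_iff)
    also have "\<dots> = (\<integral>\<^sup>+\<omega>. (\<Prod>i\<le>n. indicator (A i) (\<omega> i)) * (\<integral>\<^sup>+y. v y \<partial>mrw_kernel M K (\<omega> n)) \<partial>distr P paths (translate s))"
      by (subst nn_integral_distr[OF t]) (measurable, auto simp: * translate_def intro!: nn_integral_cong)
    finally show ?thesis .
  qed
  then show ?thesis
    unfolding markov_law_def
    by (auto intro!: prob_space.prob_space_distr D(1) t)
qed

text \<open>\<open>mrw_law\<close> only starts walks with real component 0. Starting points (x,s)
  are reached by translating the walk started at (x,0).\<close>

definition mrw_from :: "'x mrw_state \<Rightarrow> (nat \<Rightarrow> 'x mrw_state) measure" where
  "mrw_from z = distr (mrw_law M K (return M (fst z))) paths (translate (snd z))"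

text \<open>These are the two conditions imposed on the family \<open>L\<close>, so its
  measurability and Markov property carry over to the walk.\<close>

lemma mrw_from:
  assumes z: "z \<in> space states"
  shows "markov_law states (mrw_kernel M K) (mrw_from z)"
    and "distr (mrw_from z) states (\<lambda>\<omega>. \<omega> 0) = return states z"
proof -
  let ?P = "mrw_law M K (return M (fst z))"
  have x: "fst z \<in> space M" using z by (auto simp: space_pair_measure)
  have \<mu>: "prob_space (return M (fst z))" "sets (return M (fst z)) = sets M"
    using x by (simp_all add: prob_space_return)
  show "markov_law states (mrw_kernel M K) (mrw_from z)"
    unfolding mrw_from_def by (intro markov_law_translate markov_law_mrw_law \<mu>)
  note [measurable_cong] = sets_mrw_law[OF \<mu>]
  have t: "translate (snd z) \<in> ?P \<rightarrow>\<^sub>M paths" and c: "(\<lambda>\<omega>. \<omega> 0) \<in> ?P \<rightarrow>\<^sub>M states"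
    by (subst measurable_cong_sets[OF sets_mrw_law[OF \<mu>] refl], measurable)+
  have h: "(\<lambda>y. (fst y, snd z + snd y)) \<in> states \<rightarrow>\<^sub>M states" by measurable
  have "distr (mrw_from z) states (\<lambda>\<omega>. \<omega> 0) =
      distr (distr ?P states (\<lambda>\<omega>. \<omega> 0)) states (\<lambda>y. (fst y, snd z + snd y))"
    unfolding mrw_from_def
    by (subst (1 2) distr_distr) (auto simp: c t h translate_def comp_def)
  also have "\<dots> = return states z"
    unfolding distr_mrw_law_0[OF \<mu>] using x
    by (simp add: distr_return h space_pair_measure)
  finally show "distr (mrw_from z) states (\<lambda>\<omega>. \<omega> 0) = return states z" .
qed

lemma mrw_law_return_eq_mrw_from: "x \<in> space M \<Longrightarrow> mrw_law M K (return M x) = mrw_from (x, 0)"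
proof -
  assume "x \<in> space M"
  then have "sets (mrw_law M K (return M x)) = sets paths"
    by (intro sets_mrw_law prob_space_return) auto
  then show ?thesis
    unfolding mrw_from_def translate_def by (simp add: distr_id2)
qed

lemma measurable_mrw_law_return:
  "(\<lambda>x. mrw_law M K (return M x)) \<in> M \<rightarrow>\<^sub>M prob_algebra paths"
proof -
  have "(\<lambda>x. mrw_from (x, 0)) \<in> M \<rightarrow>\<^sub>M prob_algebra paths"
    by (rule measurable_compose[OF _ measurable_markov_family[OF measurable_mrw_kernel mrw_from]])
      auto
  then show ?thesis
    by (subst measurable_cong[OF mrw_law_return_eq_mrw_from]) 
qed

text \<open>The Markov property in the form used for recurrence: the future after time
  \<open>k\<close> is a fresh walk from (X_k, 0), translated by S_k.\<close>

lemma mrw_markov_property: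
  assumes \<mu>: "prob_space \<mu>" "sets \<mu> = sets M" and F: "F \<in> sets paths"
  shows "emeasure (mrw_law M K \<mu>) {\<omega> \<in> space paths. (\<lambda>i. \<omega> (k + i)) \<in> F} =
    (\<integral>\<^sup>+\<omega>. emeasure (mrw_law M K (return M (fst (\<omega> k))))
      {\<omega>' \<in> space paths. translate (snd (\<omega> k)) \<omega>' \<in> F} \<partial>mrw_law M K \<mu>)"
proof -
  have "emeasure (mrw_law M K \<mu>) {\<omega> \<in> space paths. (\<lambda>i. \<omega> (k + i)) \<in> F} =
      (\<integral>\<^sup>+\<omega>. emeasure (mrw_from (\<omega> k)) F \<partial>mrw_law M K \<mu>)"
    using markov_property[OF measurable_mrw_kernel mrw_from markov_law_mrw_law[OF \<mu>] F]
    by (simp add: space_mrw_law[OF \<mu>])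
  also have "\<dots> = (\<integral>\<^sup>+\<omega>. emeasure (mrw_law M K (return M (fst (\<omega> k))))
      {\<omega>' \<in> space paths. translate (snd (\<omega> k)) \<omega>' \<in> F} \<partial>mrw_law M K \<mu>)"
  proof (rule nn_integral_cong)
    fix \<omega> assume "\<omega> \<in> space (mrw_law M K \<mu>)"
    then have x: "fst (\<omega> k) \<in> space M"
      by (auto simp: space_mrw_law[OF \<mu>] space_PiM PiE_iff space_pair_measure dest!: spec[of _ k])
    then have \<delta>: "prob_space (return M (fst (\<omega> k)))" "sets (return M (fst (\<omega> k))) = sets M"
      by (simp_all add: prob_space_return)
    have "translate (snd (\<omega> k)) \<in> mrw_law M K (return M (fst (\<omega> k))) \<rightarrow>\<^sub>M paths"
      by (subst measurable_cong_sets[OF sets_mrw_law[OF \<delta>] refl]) measurable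
    then show "emeasure (mrw_from (\<omega> k)) F = emeasure (mrw_law M K (return M (fst (\<omega> k))))
        {\<omega>' \<in> space paths. translate (snd (\<omega> k)) \<omega>' \<in> F}"
      unfolding mrw_from_def
      by (subst emeasure_distr[OF _ F]) (auto simp: space_mrw_law[OF \<delta>] intro!: arg_cong2[where f=emeasure])
  qed
  finally show ?thesis .
qed

text \<open>Disintegration over the starting point: the Markov property at time 0, where the state
  is (x,0) with \<open>x\<close> distributed as \<open>\<mu>\<close>.\<close>

lemma emeasure_mrw_law:
  assumes \<mu>: "prob_space \<mu>" "sets \<mu> = sets M" and F: "F \<in> sets paths"
  shows "emeasure (mrw_law M K \<mu>) F = (\<integral>\<^sup>+x. emeasure (mrw_law M K (return M x)) F \<partial>\<mu>)"
proof -
  have c: "(\<lambda>\<omega>. \<omega> 0) \<in> mrw_law M K \<mu> \<rightarrow>\<^sub>M states"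
    by (subst measurable_cong_sets[OF sets_mrw_law[OF \<mu>] refl]) measurable
  have i: "(\<lambda>x. (x, 0)) \<in> \<mu> \<rightarrow>\<^sub>M states"
    by (subst measurable_cong_sets[OF \<mu>(2) refl]) measurable
  have m: "(\<lambda>z. emeasure (mrw_from z) F) \<in> borel_measurable states"
    by (rule measurable_compose[OF measurable_prob_algebraD[OF
          measurable_markov_family[OF measurable_mrw_kernel mrw_from]]
          measurable_emeasure_subprob_algebra[OF F]])
  have "emeasure (mrw_law M K \<mu>) F = (\<integral>\<^sup>+\<omega>. emeasure (mrw_from (\<omega> 0)) F \<partial>mrw_law M K \<mu>)"
    using markov_property[OF measurable_mrw_kernel mrw_from markov_law_mrw_law[OF \<mu>] F, of 0]
      sets.sets_into_space[OF F] by (simp add: space_mrw_law[OF \<mu>] Int_absorb1 Collect_mem_eq flip: Int_def)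
  also have "\<dots> = (\<integral>\<^sup>+z. emeasure (mrw_from z) F \<partial>distr \<mu> states (\<lambda>x. (x, 0)))"
    unfolding distr_mrw_law_0[OF \<mu>, symmetric] using m by (subst nn_integral_distr[OF c]) auto
  also have "\<dots> = (\<integral>\<^sup>+x. emeasure (mrw_law M K (return M x)) F \<partial>\<mu>)"
    using m sets_eq_imp_space_eq[OF \<mu>(2)]
    by (subst nn_integral_distr[OF i]) (auto simp: mrw_law_return_eq_mrw_from intro!: nn_integral_cong)
  finally show ?thesis .
qed

end

section \<open>Recurrence\<close>

lemma INFM_nat_shift: "(\<exists>\<^sub>\<infinity>k. Q (n + k)) \<longleftrightarrow> (\<exists>\<^sub>\<infinity>k::nat. Q k)"
proof -
  have "(\<forall>\<^sub>F k in sequentially. \<not> Q (k + n)) \<longleftrightarrow> (\<forall>\<^sub>F k in sequentially. \<not> Q k)"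
    by (rule eventually_sequentially_seg)
  then show ?thesis
    by (simp add: frequently_def cofinite_eq_sequentially add.commute)
qed

text \<open>All of \<open>D\<close> lies in the window of length \<open>N\<close> that starts at its
  least element.\<close>

lemma card_le_of_diffs_less:
  fixes D :: "nat set"
  assumes "\<And>i j. i \<in> D \<Longrightarrow> j \<in> D \<Longrightarrow> i < j \<Longrightarrow> j < i + N" "0 < N"
  shows "card D \<le> N"
proof (cases "D = {}")
  case False
  define i where "i = (LEAST i. i \<in> D)"
  have i: "i \<in> D" "\<And>j. j \<in> D \<Longrightarrow> i \<le> j"
    using False unfolding i_def by (auto intro: LeastI Least_le)
  have "D \<subseteq> {i..<i + N}"
  proof
    fix j assume "j \<in> D"
    then show "j \<in> {i..<i + N}"
      using i(2)[of j] assms(1)[OF i(1), of j] assms(2) by (cases "i < j") auto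
  qed
  then have "card D \<le> card {i..<i + N}"
    by (intro card_mono) auto
  then show ?thesis by simp
qed simp

text \<open>The sum is the expected number of indices below \<open>k\<close> whose event occurs, and
  on every sample point that number is at most \<open>N\<close>.\<close>

lemma (in prob_space) sum_prob_le_of_diffs_less:
  assumes E: "\<And>n::nat. E n \<in> events"
    and diffs: "\<And>\<omega> i j. \<omega> \<in> E i \<Longrightarrow> \<omega> \<in> E j \<Longrightarrow> i < j \<Longrightarrow> j < i + N" and "0 < N"
  shows "(\<Sum>n<k. prob (E n)) \<le> N"
proof -
  have "(\<Sum>n<k. prob (E n)) = expectation (\<lambda>\<omega>. \<Sum>n<k. indicator (E n) \<omega>)"
    using E by (subst Bochner_Integration.integral_sum) (auto simp: emeasure_eq_measure)
  also have "\<dots> \<le> expectation (\<lambda>\<omega>. real N)"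
  proof (rule integral_mono)
    show "integrable M (\<lambda>\<omega>. \<Sum>n<k. indicator (E n) \<omega> :: real)"
      using E by (intro Bochner_Integration.integrable_sum) (auto simp: emeasure_eq_measure)
    fix \<omega>
    have "(\<Sum>n<k. indicator (E n) \<omega> :: real) = real (card {n. n < k \<and> \<omega> \<in> E n})"
      by (simp add: indicator_def sum.If_cases Int_def)
    also have "\<dots> \<le> real N"
      using diffs \<open>0 < N\<close> by (intro of_nat_mono card_le_of_diffs_less) auto
    finally show "(\<Sum>n<k. indicator (E n) \<omega>) \<le> real N" .
  qed simp
  finally show ?thesis by (simp add: prob_space)
qed

text \<open>If one ball centred in \<open>S\<close> were null, invariance would make all balls of
  that radius centred in \<open>S\<close> null; countably many of them cover \<open>S\<close>, which
  has positive mass.\<close>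

lemma haar_measure_on_ball_pos:
  assumes S: "closed_subgroup_2d S" and m: "haar_measure_on S m" and s: "s \<in> S" and e: "0 < e"
  shows "0 < measure m (ball s e)"
proof -
  have sets[simp]: "sets m = sets borel" and null: "emeasure m (UNIV - S) = 0"
    and S_pos: "emeasure m S \<noteq> 0"
    and fin: "\<And>C. compact C \<Longrightarrow> emeasure m C < \<infinity>"
    and inv: "\<And>g A. g \<in> S \<Longrightarrow> A \<in> sets borel \<Longrightarrow> emeasure m ((\<lambda>x. x + g) ` A) = emeasure m A"
    using m by (auto simp: haar_measure_on_def)
  have "emeasure m (ball s e) \<noteq> 0"
  proof
    assume *: "emeasure m (ball s e) = 0"
    obtain D where D: "countable D" "D \<subseteq> S" "S \<subseteq> closure D"
      using separable[of S] by blast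
    have ball: "ball d e \<in> null_sets m" if "d \<in> D" for d
    proof -
      have "d - s \<in> S"
        using that D(2) s S by (auto simp: closed_subgroup_2d_def)
      then have "emeasure m ((\<lambda>x. x + (d - s)) ` ball s e) = 0"
        using inv[of "d - s" "ball s e"] * by simp
      moreover have "(\<lambda>x. x + (d - s)) ` ball s e = ball d e"
        using ball_translation[of "d - s" s e] by (simp add: add.commute)
      ultimately show ?thesis by auto
    qed
    have "(\<Union>d\<in>D. ball d e) \<in> null_sets m"
      using D(1) ball by (intro null_sets_UN') auto
    moreover have "S \<subseteq> (\<Union>d\<in>D. ball d e)"
    proof
      fix x assume "x \<in> S"
      then have "x \<in> closure D" using D by auto
      then obtain d where "d \<in> D" "dist d x < e"
        using e closure_approachable by blast
      then show "x \<in> (\<Union>d\<in>D. ball d e)" by auto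
    qed
    moreover have "S \<in> sets m"
      using S by (simp add: closed_subgroup_2d_def)
    ultimately show False
      using S_pos null_sets_subset by blast
  qed
  \<comment> \<open>Finiteness is part of the claim, since \<open>measure\<close> assigns 0 to sets
    of infinite mass.\<close>
  moreover have "emeasure m (ball s e) \<le> emeasure m (cball s e)"
    by (intro emeasure_mono) auto
  then have "emeasure m (ball s e) < \<infinity>"
    using fin[of "cball s e"] by (auto simp: order.strict_trans1)
  ultimately show ?thesis
    by (auto simp: measure_def enn2real_positive_iff zero_less_iff_neq_zero)
qed

text \<open>Formed in the product space and not in the space of one law, so that the same set serves
  for every starting point.\<close>

definition visits :: "'x measure \<Rightarrow> real ^ 2 \<Rightarrow> real \<Rightarrow> (nat \<Rightarrow> 'x mrw_state) set" where
  "visits M s e =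
    {\<omega> \<in> space (\<Pi>\<^sub>M i\<in>UNIV. M \<Otimes>\<^sub>M borel). \<exists>\<^sub>\<infinity>k. norm (snd (\<omega> k) - s) < e}"

section \<open>Walks started from a single point\<close>

context mrw
begin

abbreviation law_from :: "'x \<Rightarrow> (nat \<Rightarrow> 'x mrw_state) measure" where
  "law_from x \<equiv> mrw_law M K (return M x)"

lemma sets_visits[measurable]: "visits M s e \<in> sets paths"
  unfolding visits_def INFM_nat_le by measurable

lemma sets_shift_vimage:
  assumes "F \<in> sets paths"
  shows "{\<omega> \<in> space paths. (\<lambda>i. \<omega> (n + i)) \<in> F} \<in> sets paths"
proof -
  have "(\<lambda>\<omega> i. \<omega> (n + i)) \<in> paths \<rightarrow>\<^sub>M paths"
    by (rule measurable_PiM_single') (auto simp: space_PiM)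
  from measurable_sets[OF this assms] show ?thesis
    by (simp only: vimage_def Int_def mem_Collect_eq conj_commute)
qed

lemma sets_translate_vimage:
  assumes "F \<in> sets paths"
  shows "{\<omega> \<in> space paths. translate t \<omega> \<in> F} \<in> sets paths"
  using measurable_sets[OF translate_measurable assms, of t]
  by (simp only: vimage_def Int_def mem_Collect_eq conj_commute)

lemma law_from:
  assumes "x \<in> space M"
  shows "prob_space (law_from x)" "sets (law_from x) = sets paths" "space (law_from x) = space paths"
  using assms prob_space_mrw_law sets_mrw_law space_mrw_law
  by (simp_all add: prob_space_return)

lemma mrw_law:
  assumes "prob_space \<mu>" "sets \<mu> = sets M"
  shows "prob_space (mrw_law M K \<mu>)" "sets (mrw_law M K \<mu>) = sets paths"
    "space (mrw_law M K \<mu>) = space paths"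
  using prob_space_mrw_law[OF assms] sets_mrw_law[OF assms] space_mrw_law[OF assms]
  by simp_all

lemma measurable_measure_law_from:
  assumes "F \<in> sets paths"
  shows "(\<lambda>x. measure (law_from x) F) \<in> borel_measurable M"
  using measurable_measure_prob_algebra[OF assms]
  by (rule measurable_compose[OF measurable_mrw_law_return])

lemma sets_measure_law_from_eq:
  assumes "F \<in> sets paths"
  shows "{x \<in> space M. measure (law_from x) F = c} \<in> sets M"
proof -
  have "(\<lambda>x. measure (law_from x) F) -` {c} \<inter> space M \<in> sets M"
    by (rule measurable_sets[OF measurable_measure_law_from[OF assms] borel_singleton[OF sets.empty_sets]])
  moreover have "(\<lambda>x. measure (law_from x) F) -` {c} \<inter> space M = {x \<in> space M. measure (law_from x) F = c}"
    by blast
  ultimately show ?thesis by simp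
qed

lemma law_from_AE_start:
  assumes x: "x \<in> space M" and A: "A \<in> sets states"
  shows "AE \<omega> in law_from x. \<omega> 0 \<in> A \<longleftrightarrow> (x, 0) \<in> A"
proof -
  have m: "(\<lambda>\<omega>. \<omega> 0) \<in> law_from x \<rightarrow>\<^sub>M states"
    by (subst measurable_cong_sets[OF law_from(2)[OF x] refl]) measurable
  have \<delta>: "prob_space (return M x)" "sets (return M x) = sets M"
    using x by (simp_all add: prob_space_return)
  have eq: "distr (law_from x) states (\<lambda>\<omega>. \<omega> 0) = return states (x, 0)"
    unfolding distr_mrw_law_0[OF \<delta>] using x by (subst distr_return) auto
  have [measurable]: "A \<in> sets states" by fact
  have "AE z in return states (x, 0). z \<in> A \<longleftrightarrow> (x, 0) \<in> A"
    using x by (subst AE_return) (auto simp: space_pair_measure)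
  then show ?thesis
    unfolding eq[symmetric] by (subst (asm) AE_distr_iff[OF m]) auto
qed

text \<open>By disintegration, an event that is certain from \<open>\<mu>\<close>-almost every point
  is certain under the mixed law.\<close>

lemma measure_mrw_law_eq_1:
  assumes \<mu>: "prob_space \<mu>" "sets \<mu> = sets M" and F: "F \<in> sets paths"
    and ae: "AE x in \<mu>. measure (law_from x) F = 1"
  shows "measure (mrw_law M K \<mu>) F = 1"
proof -
  interpret prob_space \<mu> by fact
  have "emeasure (mrw_law M K \<mu>) F = (\<integral>\<^sup>+x. emeasure (law_from x) F \<partial>\<mu>)"
    by (rule emeasure_mrw_law[OF \<mu> F])
  also have "\<dots> = (\<integral>\<^sup>+x. 1 \<partial>\<mu>)"
  proof (rule nn_integral_cong_AE)
    show "AE x in \<mu>. emeasure (law_from x) F = 1"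
      using ae AE_space
    proof eventually_elim
      case (elim x)
      then interpret X: prob_space "law_from x"
        using law_from(1) sets_eq_imp_space_eq[OF \<mu>(2)] by blast
      show ?case using elim by (simp add: X.emeasure_eq_measure)
    qed
  qed
  finally show ?thesis by (simp add: emeasure_space_1 measure_def)
qed

lemma translate_in_visits:
  assumes "\<omega> \<in> visits M (s - t) e"
  shows "translate t \<omega> \<in> visits M s e"
  using assms measurable_space[OF translate_measurable, of \<omega> M]
  by (auto simp: visits_def translate_def algebra_simps)

end

section \<open>Consequences of the local limit hypothesis\<close>

locale mrw_local_limit = mrw M K
  for M :: "'x measure" and K :: "'x \<Rightarrow> 'x mrw_state measure" +
  fixes \<pi> :: "'x measure" and S :: "(real ^ 2) set" and m :: "(real ^ 2) measure"
    and a :: "nat \<Rightarrow> real" and \<epsilon>S :: real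
  assumes \<pi>: "prob_space \<pi>" "sets \<pi> = sets M"
    and subgroup: "closed_subgroup_2d S"
    and haar: "haar_measure_on S m"
    and eps_pos: "\<epsilon>S > 0"
    and a_div: "\<not> summable (\<lambda>n. a (Suc n))"
    and LL0: "\<And>s \<epsilon> f. s \<in> S \<Longrightarrow> 0 < \<epsilon> \<Longrightarrow> \<epsilon> < \<epsilon>S \<Longrightarrow> f \<in> borel_measurable M \<Longrightarrow>
        (\<forall>x\<in>space M. 0 \<le> f x) \<Longrightarrow> bounded (f ` space M) \<Longrightarrow>
        (\<lambda>n. \<integral>\<omega>. f (fst (\<omega> n)) * indicator (ball s \<epsilon>) (snd (\<omega> n)) \<partial>mrw_law M K \<pi>)
          \<sim>[at_top] (\<lambda>n. a n * (\<integral>x. f x \<partial>\<pi>) * measure m (ball s \<epsilon>))"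
begin

lemma uminus_mem: "s \<in> S \<Longrightarrow> - s \<in> S"
  using subgroup unfolding closed_subgroup_2d_def by (metis diff_0)

text \<open>By the local limit hypothesis the terms behave like \<open>a n\<close> times the
  constant \<open>c\<close> below. A nonzero \<open>c\<close> would make \<open>a\<close> summable;
  as the ball has positive mass, the integral of \<open>f\<close> must vanish.\<close>

lemma null_of_summable:
  fixes f :: "'x \<Rightarrow> real"
  assumes s: "s \<in> S" "0 < e" "e < \<epsilon>S" and f: "f \<in> borel_measurable M"
    and f01: "\<And>x. x \<in> space M \<Longrightarrow> 0 \<le> f x \<and> f x \<le> 1"
    and sum: "summable (\<lambda>n. \<integral>\<omega>. f (fst (\<omega> n)) * indicator (ball s e) (snd (\<omega> n)) \<partial>mrw_law M K \<pi>)"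
      (is "summable ?u")
  shows "AE x in \<pi>. f x = 0"
proof -
  interpret \<pi>: prob_space \<pi> by (rule \<pi>(1))
  have sp: "space \<pi> = space M" using \<pi>(2) by (rule sets_eq_imp_space_eq)
  have [measurable]: "f \<in> borel_measurable \<pi>"
    using f by (simp add: measurable_cong_sets[OF \<pi>(2) refl])
  have nn: "AE x in \<pi>. 0 \<le> f x" using f01 by (intro AE_I2) (auto simp: sp)
  have int: "integrable \<pi> f"
    using f01 by (intro \<pi>.integrable_const_bound[where B=1]) (auto simp: sp)
  define c where "c = (\<integral>x. f x \<partial>\<pi>) * measure m (ball s e)"
  have "c = 0"
  proof (rule ccontr)
    assume "c \<noteq> 0"
    have "?u \<sim>[at_top] (\<lambda>n. a n * c)"
      using LL0[OF s f] f01 unfolding c_def mult.assoc by (force simp: bounded_iff)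
    \<comment> \<open>Equivalence is used in the reverse direction: the comparison test needs the
      explicit sequence bounded by the integrals.\<close>
    then have "(\<lambda>n. a n * c) \<in> O(?u)"
      by (intro asymp_equiv_imp_bigo) (simp only: asymp_equiv_sym)
    moreover have "0 \<le> ?u n" for n
      using f01 mrw_law(3)[OF \<pi>]
      by (intro integral_nonneg_AE AE_I2)
        (auto simp: space_PiM PiE_iff space_pair_measure mem_Times_iff indicator_def)
    then have "summable (\<lambda>n. norm (?u n))"
      using sum by simp
    ultimately have "summable (\<lambda>n. a n * c)"
      by (rule summable_comparison_test_bigo[rotated])
    then have "summable a"
      using \<open>c \<noteq> 0\<close> summable_mult2[of "\<lambda>n. a n * c" "inverse c"] by (simp add: mult.assoc)
    then show False
      using a_div summable_Suc_iff by blast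
  qed
  then have "(\<integral>x. f x \<partial>\<pi>) = 0"
    using haar_measure_on_ball_pos[OF subgroup haar s(1,2)] by (simp add: c_def)
  then show ?thesis
    using integral_nonneg_eq_0_iff_AE[OF int nn] by simp
qed

text \<open>Transfers summability from events of the whole walk to the integrals of
  \<open>null_of_summable\<close>. The set \<open>G\<close> describes a fresh walk from 0, and
  \<open>F\<close> the same future without recentring. Being in the ball at time \<open>n\<close>
  and then following \<open>G\<close> forces the shifted path into \<open>F\<close>, so the Markov
  property bounds each integral by the probability of the shifted event.\<close>

lemma AE_measure_law_from_eq_0:
  assumes s: "s \<in> S" "0 < e" "e < \<epsilon>S" and G: "G \<in> sets paths" and F: "F \<in> sets paths"
    and GF: "\<And>t \<omega>. t \<in> ball s e \<Longrightarrow> \<omega> \<in> G \<Longrightarrow> snd (\<omega> 0) = 0 \<Longrightarrow> translate t \<omega> \<in> F"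
    and sum: "summable (\<lambda>n. measure (mrw_law M K \<pi>) {\<omega> \<in> space paths. (\<lambda>i. \<omega> (n + i)) \<in> F})"
      (is "summable ?v")
  shows "AE x in \<pi>. measure (law_from x) G = 0"
proof (rule null_of_summable[OF s])
  let ?f = "\<lambda>x. measure (law_from x) G"
  show "?f \<in> borel_measurable M" using G by (rule measurable_measure_law_from)
  show "0 \<le> ?f x \<and> ?f x \<le> 1" if "x \<in> space M" for x
    using law_from(1)[OF that] by (auto intro: prob_space.prob_le_1)
  interpret P: prob_space "mrw_law M K \<pi>" by (rule mrw_law(1)[OF \<pi>])
  note [measurable_cong] = mrw_law(2)[OF \<pi>]
  note measurable_measure_law_from[OF G, measurable]
  let ?u = "\<lambda>n. \<integral>\<omega>. ?f (fst (\<omega> n)) * indicator (ball s e) (snd (\<omega> n)) \<partial>mrw_law M K \<pi>"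
  have "norm (?u n) \<le> ?v n" for n
  proof -
    have nn: "0 \<le> ?f (fst (\<omega> n)) * indicator (ball s e) (snd (\<omega> n))" for \<omega>
      by simp
    have f: "(\<lambda>\<omega>. ?f (fst (\<omega> n))) \<in> borel_measurable (mrw_law M K \<pi>)"
      by (rule measurable_compose[where f="\<lambda>\<omega>. fst (\<omega> n)" and N=M,
            OF _ measurable_measure_law_from[OF G]]) measurable
    have S: "(\<lambda>\<omega>. snd (\<omega> n)) \<in> borel_measurable (mrw_law M K \<pi>)"
      by measurable
    have meas: "(\<lambda>\<omega>. ?f (fst (\<omega> n)) * indicator (ball s e) (snd (\<omega> n))) \<in> borel_measurable (mrw_law M K \<pi>)"
      using f measurable_compose[OF S borel_measurable_indicator[of "ball s e"]]
      by (rule borel_measurable_times) simp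
    \<comment> \<open>Only an inequality is claimed: \<open>ennreal (enn2real r)\<close> equals
      \<open>r\<close>, or 0 when \<open>r\<close> is infinite.\<close>
    have "ennreal (?u n) \<le> (\<integral>\<^sup>+\<omega>. ennreal (?f (fst (\<omega> n)) * indicator (ball s e) (snd (\<omega> n))) \<partial>mrw_law M K \<pi>)"
      using integral_eq_nn_integral[OF meas] nn by (simp add: ennreal_enn2real_if)
    also have "\<dots> \<le> (\<integral>\<^sup>+\<omega>. emeasure (law_from (fst (\<omega> n)))
        {\<omega>' \<in> space paths. translate (snd (\<omega> n)) \<omega>' \<in> F} \<partial>mrw_law M K \<pi>)"
    proof (rule nn_integral_mono)
      fix \<omega> assume "\<omega> \<in> space (mrw_law M K \<pi>)"
      then have x: "fst (\<omega> n) \<in> space M"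
        by (auto simp: mrw_law(3)[OF \<pi>] space_PiM PiE_iff space_pair_measure mem_Times_iff)
      interpret X: prob_space "law_from (fst (\<omega> n))" by (rule law_from(1)[OF x])
      show "ennreal (?f (fst (\<omega> n)) * indicator (ball s e) (snd (\<omega> n))) \<le>
          emeasure (law_from (fst (\<omega> n))) {\<omega>' \<in> space paths. translate (snd (\<omega> n)) \<omega>' \<in> F}"
      proof (cases "snd (\<omega> n) \<in> ball s e")
        case True
        have "emeasure (law_from (fst (\<omega> n))) G \<le>
            emeasure (law_from (fst (\<omega> n))) {\<omega>' \<in> space paths. translate (snd (\<omega> n)) \<omega>' \<in> F}"
        proof (rule emeasure_mono_AE)
          show "{\<omega>' \<in> space paths. translate (snd (\<omega> n)) \<omega>' \<in> F} \<in> sets (law_from (fst (\<omega> n)))"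
            unfolding law_from(2)[OF x] by (rule sets_translate_vimage[OF F])
          \<comment> \<open>The fresh walk starts at 0 almost surely, which supplies the premise of
            \<open>GF\<close> on the initial position.\<close>
          have "AE \<omega>' in law_from (fst (\<omega> n)). snd (\<omega>' 0) = 0"
            using x by (intro mrw_law_AE_start prob_space_return) auto
          then show "AE \<omega>' in law_from (fst (\<omega> n)). \<omega>' \<in> G \<longrightarrow>
              \<omega>' \<in> {\<omega>' \<in> space paths. translate (snd (\<omega> n)) \<omega>' \<in> F}"
          proof eventually_elim
            case (elim \<omega>')
            then show ?case using GF[OF True] sets.sets_into_space[OF G] by auto
          qed
        qed
        then show ?thesis using True by (simp add: X.emeasure_eq_measure)
      qed simp
    qed
    also have "\<dots> = emeasure (mrw_law M K \<pi>) {\<omega> \<in> space paths. (\<lambda>i. \<omega> (n + i)) \<in> F}"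
      by (rule mrw_markov_property[OF \<pi> F, symmetric])
    finally have "?u n \<le> ?v n"
      by (simp add: P.emeasure_eq_measure)
    moreover have "0 \<le> ?u n"
      by (rule integral_nonneg_AE) simp
    ultimately show ?thesis by simp
  qed
  then show "summable ?u"
    using sum by (rule summable_comparison_test'[rotated])
qed

text \<open>The last exit argument: \<open>G N\<close> is avoidance of the ball of radius
  \<open>2 * e\<close> from time \<open>N\<close> on. Each such set is null from almost every point,
  and off their union the path returns infinitely often.\<close>

lemma AE_visits_0:
  assumes e: "0 < e" "e < \<epsilon>S"
  shows "AE x in \<pi>. measure (law_from x) (visits M 0 (2 * e)) = 1"
proof -
  define G where "G N = {\<omega> \<in> space paths. \<forall>k\<ge>N. 2 * e \<le> norm (snd (\<omega> k))}" for N :: nat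
  have G: "G N \<in> sets paths" for N
    unfolding G_def by measurable
  \<comment> \<open>Taking \<open>Suc N\<close> keeps the window length positive, as the counting
    lemma demands.\<close>
  have "AE x in \<pi>. measure (law_from x) (G (Suc N)) = 0" for N
  proof (rule AE_measure_law_from_eq_0[of 0 e])
    \<comment> \<open>The radius drops from \<open>2 * e\<close> to \<open>e\<close> because the
      starting position is displaced by less than \<open>e\<close>.\<close>
    let ?F = "{\<omega> \<in> space paths. norm (snd (\<omega> 0)) < e \<and> (\<forall>k\<ge>Suc N. e \<le> norm (snd (\<omega> k)))}"
    let ?E = "\<lambda>n. {\<omega> \<in> space paths. (\<lambda>i. \<omega> (n + i)) \<in> ?F}"
    show F: "?F \<in> sets paths" by measurable
    show "translate t \<omega> \<in> ?F" if "t \<in> ball 0 e" "\<omega> \<in> G (Suc N)" "snd (\<omega> 0) = 0" for t \<omega>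
    proof -
      have "e \<le> norm (t + snd (\<omega> k))" if "Suc N \<le> k" for k
      proof -
        have "2 * e \<le> norm (snd (\<omega> k))"
          using \<open>\<omega> \<in> G (Suc N)\<close> that by (auto simp: G_def)
        moreover have "norm (snd (\<omega> k)) \<le> norm (t + snd (\<omega> k)) + norm t"
          using norm_triangle_ineq4[of "t + snd (\<omega> k)" t] by simp
        ultimately show ?thesis using \<open>t \<in> ball 0 e\<close> by simp
      qed
      then show ?thesis
        using that measurable_space[OF translate_measurable, of \<omega> M]
        by (auto simp: G_def translate_def)
    qed
    interpret P: prob_space "mrw_law M K \<pi>" by (rule mrw_law(1)[OF \<pi>])
    have E: "?E n \<in> P.events" for n
      unfolding mrw_law(2)[OF \<pi>] by (rule sets_shift_vimage[OF F])
    \<comment> \<open>The event at \<open>j\<close> puts the path inside the ball at time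
      \<open>j\<close>, while the event at \<open>i\<close> keeps it outside from time
      \<open>i + Suc N\<close> on.\<close>
    have "j < i + Suc N" if "\<omega> \<in> ?E i" "\<omega> \<in> ?E j" "i < j" for \<omega> i j
    proof (rule ccontr)
      assume "\<not> j < i + Suc N"
      then have "Suc N \<le> j - i" "i + (j - i) = j" using that(3) by auto
      then show False using that(1,2) by (force dest!: spec[of _ "j - i"])
    qed
    then have "(\<Sum>n<k. P.prob (?E n)) \<le> real (Suc N)" for k
      by (intro P.sum_prob_le_of_diffs_less E) auto
    then show "summable (\<lambda>n. P.prob (?E n))"
      by (intro summableI_nonneg_bounded) auto
  qed (use G e subgroup in \<open>auto simp: closed_subgroup_2d_def\<close>)
  then have "AE x in \<pi>. \<forall>N. measure (law_from x) (G (Suc N)) = 0"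
    by (simp add: AE_all_countable)
  then show ?thesis
    using AE_space
  proof eventually_elim
    case (elim x)
    then have x: "x \<in> space M" using sets_eq_imp_space_eq[OF \<pi>(2)] by simp
    interpret X: prob_space "law_from x" by (rule law_from(1)[OF x])
    have "G (Suc N) \<in> null_sets (law_from x)" for N
      using elim G law_from(2)[OF x] by (auto simp: X.emeasure_eq_measure)
    then have "AE \<omega> in law_from x. \<omega> \<notin> G (Suc N)" for N
      by (rule AE_not_in)
    then have "AE \<omega> in law_from x. \<forall>N. \<omega> \<notin> G (Suc N)"
      by (simp add: AE_all_countable)
    then have "AE \<omega> in law_from x. \<omega> \<in> visits M 0 (2 * e)"
      using AE_space
    proof eventually_elim
      case (elim \<omega>)
      then have "\<forall>N. \<exists>k\<ge>Suc N. norm (snd (\<omega> k)) < 2 * e"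
        by (auto simp: G_def law_from(3)[OF x] not_le)
      then have "\<exists>\<^sub>\<infinity>k. norm (snd (\<omega> k)) < 2 * e"
        unfolding INFM_nat_le by (meson Suc_leD)
      then show ?case using elim by (simp add: visits_def law_from(3)[OF x])
    qed
    then show ?case
      by (subst X.prob_eq_1) (simp_all add: law_from(2)[OF x])
  qed
qed

text \<open>Here the local limit is taken near \<open>- s\<close>. A walk that is near
  \<open>- s\<close> at time \<open>n\<close> and whose future increments approach \<open>s\<close>
  only finitely often would return to 0 only finitely often. By \<open>AE_visits_0\<close> this has
  probability 0 for every \<open>n\<close>, so the sum to be bounded is zero.\<close>

lemma AE_visits:
  assumes s: "s \<in> S" and \<epsilon>: "0 < \<epsilon>"
  shows "AE x in \<pi>. measure (law_from x) (visits M s \<epsilon>) = 1"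
proof -
  \<comment> \<open>A third of \<open>\<epsilon>\<close> leaves room for \<open>2 * e\<close> from
    the return to 0 and \<open>e\<close> from the position near \<open>- s\<close>; half of
    \<open>\<epsilon>S\<close> gives the strict bound of the hypothesis.\<close>
  define e where "e = min (\<epsilon> / 3) (\<epsilon>S / 2)"
  have e: "0 < e" "e < \<epsilon>S" "3 * e \<le> \<epsilon>" using \<epsilon> eps_pos by (auto simp: e_def)
  interpret P: prob_space "mrw_law M K \<pi>" by (rule mrw_law(1)[OF \<pi>])
  have rec: "AE \<omega> in mrw_law M K \<pi>. \<omega> \<in> visits M 0 (2 * e)"
    using measure_mrw_law_eq_1[OF \<pi> sets_visits AE_visits_0[OF e(1,2)]]
    by (subst (asm) P.prob_eq_1) (simp_all add: mrw_law(2)[OF \<pi>])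
  let ?G = "space paths - visits M s \<epsilon>"
  have "AE x in \<pi>. measure (law_from x) ?G = 0"
  proof (rule AE_measure_law_from_eq_0[of "- s" e])
    let ?F = "{\<omega> \<in> space paths. \<not> (\<exists>\<^sub>\<infinity>k. norm (snd (\<omega> k)) < 2 * e)}"
    show F: "?F \<in> sets paths" unfolding INFM_nat_le by measurable
    show "translate t \<omega> \<in> ?F" if t: "t \<in> ball (- s) e" and \<omega>: "\<omega> \<in> ?G" and "snd (\<omega> 0) = 0" for t \<omega>
    proof -
      have "norm (snd (\<omega> k) - s) < \<epsilon>" if "norm (t + snd (\<omega> k)) < 2 * e" for k
      proof -
        have "norm (snd (\<omega> k) - s) \<le> norm (t + snd (\<omega> k)) + norm (- s - t)"
          using norm_triangle_ineq[of "t + snd (\<omega> k)" "- s - t"] by simp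
        then show ?thesis using that t e by (simp add: dist_norm)
      qed
      moreover have "\<not> (\<exists>\<^sub>\<infinity>k. norm (snd (\<omega> k) - s) < \<epsilon>)"
        using \<omega> by (auto simp: visits_def)
      ultimately have "\<not> (\<exists>\<^sub>\<infinity>k. norm (t + snd (\<omega> k)) < 2 * e)"
        using INFM_mono[of "\<lambda>k. norm (t + snd (\<omega> k)) < 2 * e" "\<lambda>k. norm (snd (\<omega> k) - s) < \<epsilon>"] by blast
      then show ?thesis
        using \<omega> measurable_space[OF translate_measurable, of \<omega> M] by (auto simp: translate_def)
    qed
    have "P.prob {\<omega> \<in> space paths. (\<lambda>i. \<omega> (n + i)) \<in> ?F} = 0" for n
    proof -
      have "AE \<omega> in mrw_law M K \<pi>. \<omega> \<notin> {\<omega> \<in> space paths. (\<lambda>i. \<omega> (n + i)) \<in> ?F}"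
        using rec
      proof eventually_elim
        case (elim \<omega>)
        then show ?case
          using INFM_nat_shift[of "\<lambda>k. norm (snd (\<omega> k)) < 2 * e" n] by (simp add: visits_def)
      qed
      then show ?thesis
        using sets_shift_vimage[OF F, of n] by (subst P.prob_eq_0) (simp_all add: mrw_law(2)[OF \<pi>])
    qed
    then show "summable (\<lambda>n. P.prob {\<omega> \<in> space paths. (\<lambda>i. \<omega> (n + i)) \<in> ?F})"
      by simp
  qed (use s e in \<open>auto simp: uminus_mem\<close>)
  then show ?thesis
    using AE_space
  proof eventually_elim
    case (elim x)
    then have x: "x \<in> space M" using sets_eq_imp_space_eq[OF \<pi>(2)] by simp
    interpret X: prob_space "law_from x" by (rule law_from(1)[OF x])
    show ?case
      using elim X.prob_compl[of "visits M s \<epsilon>"] by (simp add: law_from(2,3)[OF x])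
  qed
qed

text \<open>The exceptional null set of \<open>AE_visits\<close> depends on \<open>s\<close> and the
  radius. A countable dense subset of \<open>S\<close> with radii 1/(j+1) yields one null set for
  all of them. The set \<open>X\<close> has full measure; positivity is the form in which Harris
  recurrence uses it.\<close>

lemma good_starting_points:
  obtains X where "X \<in> sets M" "measure \<pi> X > 0"
    "\<And>x s e. x \<in> X \<Longrightarrow> s \<in> S \<Longrightarrow> 0 < e \<Longrightarrow> measure (law_from x) (visits M s e) = 1"
proof -
  obtain D where D: "countable D" "D \<subseteq> S" "S \<subseteq> closure D"
    using separable[of S] by blast
  define X where "X = {x \<in> space M. \<forall>d\<in>D. \<forall>j. measure (law_from x) (visits M d (inverse (real (Suc j)))) = 1}"
  interpret \<pi>: prob_space \<pi> by (rule \<pi>(1))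
  have X: "X \<in> sets M"
    unfolding X_def
  proof (intro sets.sets_Collect_countable_All' sets.sets_Collect_countable_All D(1))
    fix d and j :: nat
    show "{x \<in> space M. measure (law_from x) (visits M d (inverse (real (Suc j)))) = 1} \<in> sets M"
      by (rule sets_measure_law_from_eq[OF sets_visits])
  qed
  have "AE x in \<pi>. \<forall>d\<in>D. \<forall>j. measure (law_from x) (visits M d (inverse (real (Suc j)))) = 1"
    using D by (subst AE_ball_countable, simp, subst AE_all_countable) (auto intro!: AE_visits)
  then have "AE x in \<pi>. x \<in> X"
    using AE_space by eventually_elim (auto simp: X_def sets_eq_imp_space_eq[OF \<pi>(2)])
  then have "\<pi>.prob X = 1"
    using X \<pi>(2) by (subst \<pi>.prob_eq_1) auto
  moreover have "measure (law_from x) (visits M s e) = 1" if x: "x \<in> X" and s: "s \<in> S" and e: "0 < e" for x s e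
  proof -
    have xM: "x \<in> space M" using x by (simp add: X_def)
    interpret X: prob_space "law_from x" by (rule law_from(1)[OF xM])
    have "s \<in> closure D" using s D by auto
    then obtain d where d: "d \<in> D" "dist d s < e / 2"
      using e closure_approachable[of s D] by (meson half_gt_zero)
    obtain j where j: "inverse (real (Suc j)) < e / 2"
      using e reals_Archimedean[of "e / 2"] by auto
    have "norm (t - s) < e" if "norm (t - d) < inverse (real (Suc j))" for t
    proof -
      have "norm (t - s) \<le> norm (t - d) + norm (d - s)"
        using norm_triangle_ineq[of "t - d" "d - s"] by simp
      then show ?thesis using that d(2) j by (simp add: dist_norm)
    qed
    then have "visits M d (inverse (real (Suc j))) \<subseteq> visits M s e"
      by (auto simp: visits_def elim: INFM_mono)
    then have "X.prob (visits M d (inverse (real (Suc j)))) \<le> X.prob (visits M s e)"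
      by (intro X.finite_measure_mono) (simp_all add: law_from(2)[OF xM])
    moreover have "X.prob (visits M d (inverse (real (Suc j)))) = 1"
      using x d(1) by (simp add: X_def)
    ultimately show ?thesis
      using X.prob_le_1[of "visits M s e"] by linarith
  qed
  ultimately show thesis using that X by simp
qed

text \<open>The chain enters the good set \<open>X\<close> at some time \<open>n\<close>, with S_n
  in \<open>S\<close> almost surely. From there a fresh walk visits s - S_n infinitely often, so the
  original walk visits \<open>s\<close> infinitely often.\<close>

lemma harris_visits:
  assumes harris: "harris_recurrent M K \<pi>" and x: "x \<in> space M"
    and S_valued: "\<And>n. measure (law_from x) {\<omega> \<in> space (law_from x). snd (\<omega> n) \<in> S} = 1"
    and s: "s \<in> S" and e: "0 < e"
  shows "measure (law_from x) (visits M s e) = 1"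
proof -
  obtain X where X: "X \<in> sets M" "measure \<pi> X > 0"
    and good: "\<And>x s e. x \<in> X \<Longrightarrow> s \<in> S \<Longrightarrow> 0 < e \<Longrightarrow> measure (law_from x) (visits M s e) = 1"
    using good_starting_points by blast
  note X(1)[measurable]
  have [measurable]: "S \<in> sets borel"
    using subgroup by (simp add: closed_subgroup_2d_def)
  have \<delta>: "prob_space (return M x)" "sets (return M x) = sets M"
    using x by (simp_all add: prob_space_return)
  interpret P: prob_space "law_from x" by (rule law_from(1)[OF x])
  note [measurable_cong] = law_from(2)[OF x]
  have "AE \<omega> in law_from x. snd (\<omega> n) \<in> S" for n
    using S_valued[of n] by (subst (asm) P.prob_Collect_eq_1) measurable
  then have in_S: "AE \<omega> in law_from x. \<forall>n. snd (\<omega> n) \<in> S"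
    by (simp add: AE_all_countable)
  have "P.prob {\<omega> \<in> space (law_from x). \<exists>\<^sub>\<infinity>k. fst (\<omega> k) \<in> X} = 1"
    using harris X x unfolding harris_recurrent_def by blast
  then have in_X: "AE \<omega> in law_from x. \<exists>\<^sub>\<infinity>k. fst (\<omega> k) \<in> X"
    unfolding INFM_nat_le by (subst (asm) P.prob_Collect_eq_1) measurable
  \<comment> \<open>The bad event is shown to be null at every deterministic time \<open>n\<close>.
    Countably many such times cover the random entrance time, so the ordinary Markov property
    suffices.\<close>
  define F where "F = {\<omega> \<in> space paths. \<omega> 0 \<in> X \<times> S \<and> \<not> (\<exists>\<^sub>\<infinity>k. norm (snd (\<omega> k) - s) < e)}"
  have F: "F \<in> sets paths" unfolding F_def INFM_nat_le by measurable
  have "AE \<omega> in law_from x. (\<lambda>i. \<omega> (n + i)) \<notin> F" for n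
  proof -
    have "emeasure (law_from x) {\<omega> \<in> space paths. (\<lambda>i. \<omega> (n + i)) \<in> F} = (\<integral>\<^sup>+\<omega>. emeasure
        (law_from (fst (\<omega> n))) {\<omega>' \<in> space paths. translate (snd (\<omega> n)) \<omega>' \<in> F} \<partial>law_from x)"
      by (rule mrw_markov_property[OF \<delta> F])
    also have "\<dots> = (\<integral>\<^sup>+\<omega>. 0 \<partial>law_from x)"
    proof (rule nn_integral_cong)
      fix \<omega> assume "\<omega> \<in> space (law_from x)"
      then have y: "fst (\<omega> n) \<in> space M"
        by (auto simp: law_from(3)[OF x] space_PiM PiE_iff space_pair_measure mem_Times_iff)
      let ?y = "fst (\<omega> n)" and ?t = "snd (\<omega> n)"
      interpret Y: prob_space "law_from ?y" by (rule law_from(1)[OF y])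
      have "AE \<omega>' in law_from ?y. translate ?t \<omega>' \<notin> F"
      proof (cases "?y \<in> X \<and> ?t \<in> S")
        case True
        \<comment> \<open>The group property makes the recentred target an admissible point; this is
          why the good points must serve all of \<open>S\<close> at once.\<close>
        then have "s - ?t \<in> S" using s subgroup by (auto simp: closed_subgroup_2d_def)
        then have "Y.prob (visits M (s - ?t) e) = 1" using True good e by blast
        then have "AE \<omega>' in law_from ?y. \<omega>' \<in> visits M (s - ?t) e"
          by (subst (asm) Y.prob_eq_1) (simp_all add: law_from(2)[OF y])
        then show ?thesis
        proof eventually_elim
          case (elim \<omega>')
          then have "translate ?t \<omega>' \<in> visits M s e" by (rule translate_in_visits)
          then show ?case by (simp add: F_def visits_def)
        qed
      next
        case False
        \<comment> \<open>Outside \<open>X \<times> S\<close> the bad event fails at its initial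
          condition: the fresh walk starts at (?y, 0) almost surely, and this point is not in
          \<open>?A\<close>.\<close>
        let ?A = "{z \<in> space states. fst z \<in> X \<and> ?t + snd z \<in> S}"
        have "?A \<in> sets states" by measurable
        from law_from_AE_start[OF y this] show ?thesis
          using AE_space
        proof eventually_elim
          case (elim \<omega>')
          then show ?case
            using False by (auto simp: F_def translate_def law_from(3)[OF y] space_PiM PiE_iff)
        qed
      qed
      then show "emeasure (law_from ?y) {\<omega>' \<in> space paths. translate ?t \<omega>' \<in> F} = 0"
        by (subst law_from(3)[OF y, symmetric]) (rule emeasure_eq_0_AE)
    qed
    finally have "emeasure (law_from x) {\<omega> \<in> space paths. (\<lambda>i. \<omega> (n + i)) \<in> F} = 0"
      by simp
    moreover have "{\<omega> \<in> space paths. (\<lambda>i. \<omega> (n + i)) \<in> F} \<in> sets (law_from x)"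
      unfolding law_from(2)[OF x] by (rule sets_shift_vimage[OF F])
    ultimately have "{\<omega> \<in> space paths. (\<lambda>i. \<omega> (n + i)) \<in> F} \<in> null_sets (law_from x)"
      by auto
    from AE_not_in[OF this] show ?thesis
      using AE_space by eventually_elim (simp add: law_from(3)[OF x])
  qed
  then have "AE \<omega> in law_from x. \<forall>n. (\<lambda>i. \<omega> (n + i)) \<notin> F"
    by (simp add: AE_all_countable)
  then have "AE \<omega> in law_from x. \<omega> \<in> visits M s e"
    using in_S in_X AE_space
  proof eventually_elim
    case (elim \<omega>)
    then have \<omega>: "\<omega> \<in> space paths" by (simp add: law_from(3)[OF x])
    obtain n where n: "fst (\<omega> n) \<in> X" using elim(3) by (auto simp: INFM_nat_le)
    have "(\<lambda>i. \<omega> (n + i)) \<in> space paths" using \<omega> by (auto simp: space_PiM)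
    then have "\<exists>\<^sub>\<infinity>k. norm (snd (\<omega> (n + k)) - s) < e"
      using elim(1,2) n by (auto simp: F_def mem_Times_iff)
    then show ?case
      using \<omega> INFM_nat_shift[of "\<lambda>k. norm (snd (\<omega> k) - s) < e"] by (simp add: visits_def)
  qed
  then show ?thesis
    by (subst P.prob_eq_1) (simp_all add: law_from(2)[OF x])
qed

lemma recurrence_set_eq:
  assumes \<mu>: "prob_space \<mu>" "sets \<mu> = sets M"
    and "\<And>s e. s \<in> S \<Longrightarrow> 0 < e \<Longrightarrow> AE x in \<mu>. measure (law_from x) (visits M s e) = 1"
  shows "recurrence_set M K S \<mu> = S"
  using measure_mrw_law_eq_1[OF \<mu> sets_visits assms(3)]
  by (auto simp: recurrence_set_def mrw_law(3)[OF \<mu>] visits_def)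

end

theorem theoremI:
  fixes M :: "'x measure" and K :: "'x \<Rightarrow> 'x mrw_state measure"
    and \<pi> :: "'x measure" and S :: "(real ^ 2) set" and m :: "(real ^ 2) measure"
    and a :: "nat \<Rightarrow> real" and \<epsilon>S :: real
  assumes kernel: "K \<in> measurable M (prob_algebra (M \<Otimes>\<^sub>M borel))"
    and inv: "invariant_prob M K \<pi>"
    and integrable_S1: "integrable (mrw_law M K \<pi>) (\<lambda>\<omega>. snd (\<omega> 1))"
    and mean_zero: "(\<integral>\<omega>. snd (\<omega> 1) \<partial>mrw_law M K \<pi>) = 0"
    and subgroup: "closed_subgroup_2d S"
    and lattice_valued: "\<And>x n. x \<in> space M \<Longrightarrow>
        measure (mrw_law M K (return M x)) {\<omega> \<in> space (mrw_law M K (return M x)). snd (\<omega> n) \<in> S} = 1"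
    and haar: "haar_measure_on S m"
    and eps_pos: "\<epsilon>S > 0"
    and a_pos: "\<And>n. n \<ge> 1 \<Longrightarrow> a n > 0"
    and a_div: "\<not> summable (\<lambda>n. a (Suc n))"
    and LL0: "\<And>s \<epsilon> f. s \<in> S \<Longrightarrow> 0 < \<epsilon> \<Longrightarrow> \<epsilon> < \<epsilon>S \<Longrightarrow> f \<in> borel_measurable M \<Longrightarrow>
        (\<forall>x\<in>space M. 0 \<le> f x) \<Longrightarrow> bounded (f ` space M) \<Longrightarrow>
        (\<lambda>n. \<integral>\<omega>. f (fst (\<omega> n)) * indicator (ball s \<epsilon>) (snd (\<omega> n)) \<partial>mrw_law M K \<pi>)
          \<sim>[at_top] (\<lambda>n. a n * (\<integral>x. f x \<partial>\<pi>) * measure m (ball s \<epsilon>))"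
  shows "recurrence_set M K S \<pi> = S \<and>
    (harris_recurrent M K \<pi> \<longrightarrow>
       (\<forall>\<mu>. prob_space \<mu> \<and> sets \<mu> = sets M \<longrightarrow> recurrence_set M K S \<mu> = S))"
proof -
  have \<pi>: "prob_space \<pi>" "sets \<pi> = sets M" using inv by (auto simp: invariant_prob_def)
  interpret mrw_local_limit M K \<pi> S m a \<epsilon>S
  proof (intro mrw_local_limit.intro mrw.intro mrw_local_limit_axioms.intro)
    fix s \<epsilon> and f :: "'x \<Rightarrow> real"
    assume "s \<in> S" "0 < \<epsilon>" "\<epsilon> < \<epsilon>S" "f \<in> borel_measurable M"
      "\<forall>x\<in>space M. 0 \<le> f x" "bounded (f ` space M)"
    then show "(\<lambda>n. \<integral>\<omega>. f (fst (\<omega> n)) * indicator (ball s \<epsilon>) (snd (\<omega> n)) \<partial>mrw_law M K \<pi>)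
        \<sim>[at_top] (\<lambda>n. a n * (\<integral>x. f x \<partial>\<pi>) * measure m (ball s \<epsilon>))"
      by (rule LL0)
  qed (fact kernel \<pi> subgroup haar eps_pos a_div)+
  show ?thesis
  proof (intro conjI impI allI)
    show "recurrence_set M K S \<pi> = S"
      using \<pi> AE_visits by (rule recurrence_set_eq)
    fix \<mu> assume harris: "harris_recurrent M K \<pi>" and "prob_space \<mu> \<and> sets \<mu> = sets M"
    then have \<mu>: "prob_space \<mu>" "sets \<mu> = sets M" by auto
    \<comment> \<open>Under Harris recurrence every starting point is good, hence
      \<open>\<mu>\<close>-almost every one for arbitrary \<open>\<mu>\<close>.\<close>
    show "recurrence_set M K S \<mu> = S"
      using sets_eq_imp_space_eq[OF \<mu>(2)]
      by (intro recurrence_set_eq[OF \<mu>] AE_I2 harris_visits[OF harris _ lattice_valued]) auto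
  qed
qed

end
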